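(* Assume that $u_0$ satisfies hypothesis $(\mathbf{H_i})$ for some $i\in\{1,2,3\}$, where $(\mathbf{H_1})$: $u_0\in L^\infty(\Omega)$, $u_0\ge1$ a.e. in $\Omega$, $u_0\not\equiv1$; $(\mathbf{H_2})$: $u_0\in L^\infty(\Omega)$, $0\le u_0\le1$ a.e. in $\Omega$, $\int_\Omega g(u_0(x))\,dx\ne0$; $(\mathbf{H_3})$: $u_0\in L^\infty(\Omega)$, $u_0\le0$ a.e. in $\Omega$, $u_0\not\equiv0$. Then: (i) $\omega(u_0)$ is a nonempty set in $L^1(\Omega)$. (ii) With $E_{i\infty}:=\lim_{t\to\infty}E_i(u(t))$, one has $E_i(\varphi)=E_{i\infty}$ for all $\varphi\in\omega(u_0)$; in other words, $E_i(\cdot)$ is constant on $\omega(u_0)$. (iii) Any element $\varphi\in\omega(u_0)$ either satisfies $\int_\Omega g(\varphi)\,dx=0$ or is a stationary solution of Problem $(P)$.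
   Context: Standing assumptions: $\Omega\subset\mathbb{R}^N$ ($N\ge1$) is an open bounded set; $p\in C^1(\mathbb{R})$ is strictly increasing on $\mathbb{R}$; $g\in C^1(\mathbb{R})$ satisfies $g(0)=g(1)=0$, $g>0$ on $(0,1)$ and $g<0$ on $(-\infty,0)\cup(1,\infty)$. For $v\in L^\infty(\Omega)$ with $\int_\Omega g(v)\ne0$ put $F(v):=g(v)p(v)-g(v)\dfrac{\int_\Omega g(v)p(v)}{\int_\Omega g(v)}$. Problem $(P)$ is the initial value problem $u_t=F(u)$, $t\ge0$, $u(x,0)=u_0(x)$, $x\in\Omega$. For $0<T\le\infty$, a function $u\in C^1([0,T);L^\infty(\Omega))$ is a solution of $(P)$ on $[0,T)$ if $u(0)=u_0$, $\int_\Omega g(u(t))\ne0$ for all $t\in[0,T)$, and $\frac{du}{dt}=F(u)$ on the whole interval $[0,T)$. A stationary solution of $(P)$ is a function $\varphi\in L^\infty(\Omega)$ with $\int_\Omega g(\varphi)\ne0$ and $F(\varphi)=0$ a.e. in $\Omega$. Under any of $(\mathbf{H_1})$, $(\mathbf{H_2})$, $(\mathbf{H_3})$, Problem $(P)$ has a unique solution $u$ on $[0,\infty)$, and the $\omega$-limit set is $\omega(u_0):=\{\varphi\in L^1(\Omega):\exists\, t_n\to\infty,\ u(t_n)\to\varphi \text{ in } L^1(\Omega)\text{ as } n\to\infty\}$. Set $\mathcal{P}(s):=\int_0^s p(\tau)\,d\tau$ and, for $i=1,2,3$, $E_i(v):=(-1)^{i+1}\int_\Omega\mathcal{P}(v)$.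 Under $(\mathbf{H_i})$ the limit $\lim_{t\to\infty}E_i(u(t))$ exists. *)

theory Defs
  imports "HOL-Analysis.Analysis" "HOL-Probability.Essential_Supremum"
begin

text \<open>Elements of the Lebesgue spaces over a set \<open>\<Omega>\<close> are represented by real functions that are
  Lebesgue measurable on \<open>\<Omega>\<close>; equality in these spaces is equality almost everywhere
  with respect to \<open>lebesgue_on \<Omega>\<close>. Norms take values in \<open>ennreal\<close>.\<close>

definition Linf_norm :: "'a measure \<Rightarrow> ('a \<Rightarrow> real) \<Rightarrow> ennreal" where
  "Linf_norm M f = esssup M (\<lambda>x. ennreal \<bar>f x\<bar>)"

definition Linf :: "'a measure \<Rightarrow> ('a \<Rightarrow> real) set" where
  "Linf M = {f \<in> borel_measurable M. Linf_norm M f < \<infinity>}"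

text \<open>\<open>u \<in> C\<^sup>1(J; L\<^sup>\<infinity>)\<close> with derivative \<open>u'\<close>. At an end point that belongs to the time interval
  \<open>J\<close> the derivative is one-sided.\<close>

definition C1_Linf_on ::
    "'a measure \<Rightarrow> real set \<Rightarrow> (real \<Rightarrow> 'a \<Rightarrow> real) \<Rightarrow> (real \<Rightarrow> 'a \<Rightarrow> real) \<Rightarrow> bool" where
  "C1_Linf_on M J u u' \<longleftrightarrow>
     (\<forall>t\<in>J. u t \<in> Linf M \<and> u' t \<in> Linf M \<and>
        ((\<lambda>s. Linf_norm M (\<lambda>x. (u s x - u t x) / (s - t) - u' t x)) \<longlongrightarrow> 0) (at t within J) \<and>
        ((\<lambda>s. Linf_norm M (\<lambda>x. u' s x - u' t x)) \<longlongrightarrow> 0) (at t within J))"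

definition F :: "(real^'n) set \<Rightarrow> (real \<Rightarrow> real) \<Rightarrow> (real \<Rightarrow> real) \<Rightarrow>
    (real^'n \<Rightarrow> real) \<Rightarrow> real^'n \<Rightarrow> real" where
  "F \<Omega> p g v x = g (v x) * p (v x) -
     g (v x) * ((LINT y|lebesgue_on \<Omega>. g (v y) * p (v y)) / (LINT y|lebesgue_on \<Omega>. g (v y)))"

definition is_solution :: "(real^'n) set \<Rightarrow> (real \<Rightarrow> real) \<Rightarrow> (real \<Rightarrow> real) \<Rightarrow>
    (real^'n \<Rightarrow> real) \<Rightarrow> ereal \<Rightarrow> (real \<Rightarrow> real^'n \<Rightarrow> real) \<Rightarrow> bool" where
  "is_solution \<Omega> p g u0 T u \<longleftrightarrow>
     (let J = {t. 0 \<le> t \<and> ereal t < T} in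
       (AE x in lebesgue_on \<Omega>. u 0 x = u0 x) \<and>
       (\<forall>t\<in>J. (LINT x|lebesgue_on \<Omega>. g (u t x)) \<noteq> 0) \<and>
       (\<exists>u'. C1_Linf_on (lebesgue_on \<Omega>) J u u' \<and>
             (\<forall>t\<in>J. AE x in lebesgue_on \<Omega>. u' t x = F \<Omega> p g (u t) x)))"

definition is_stationary :: "(real^'n) set \<Rightarrow> (real \<Rightarrow> real) \<Rightarrow> (real \<Rightarrow> real) \<Rightarrow>
    (real^'n \<Rightarrow> real) \<Rightarrow> bool" where
  "is_stationary \<Omega> p g \<phi> \<longleftrightarrow>
     \<phi> \<in> Linf (lebesgue_on \<Omega>) \<and> (LINT x|lebesgue_on \<Omega>. g (\<phi> x)) \<noteq> 0 \<and>
     (AE x in lebesgue_on \<Omega>. F \<Omega> p g \<phi> x = 0)"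

definition H1 :: "(real^'n) set \<Rightarrow> (real^'n \<Rightarrow> real) \<Rightarrow> bool" where
  "H1 \<Omega> u0 \<longleftrightarrow> u0 \<in> Linf (lebesgue_on \<Omega>) \<and> (AE x in lebesgue_on \<Omega>. 1 \<le> u0 x) \<and>
     \<not> (AE x in lebesgue_on \<Omega>. u0 x = 1)"

definition H2 :: "(real^'n) set \<Rightarrow> (real \<Rightarrow> real) \<Rightarrow> (real^'n \<Rightarrow> real) \<Rightarrow> bool" where
  "H2 \<Omega> g u0 \<longleftrightarrow> u0 \<in> Linf (lebesgue_on \<Omega>) \<and>
     (AE x in lebesgue_on \<Omega>. 0 \<le> u0 x \<and> u0 x \<le> 1) \<and>
     (LINT x|lebesgue_on \<Omega>. g (u0 x)) \<noteq> 0"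

definition H3 :: "(real^'n) set \<Rightarrow> (real^'n \<Rightarrow> real) \<Rightarrow> bool" where
  "H3 \<Omega> u0 \<longleftrightarrow> u0 \<in> Linf (lebesgue_on \<Omega>) \<and> (AE x in lebesgue_on \<Omega>. u0 x \<le> 0) \<and>
     \<not> (AE x in lebesgue_on \<Omega>. u0 x = 0)"

text \<open>The \<open>\<omega>\<close>-limit set in \<open>L\<^sup>1(\<Omega>)\<close> of the orbit \<open>u\<close>, with \<open>u t\<close> meaningful only for \<open>t \<ge> 0\<close>.\<close>

definition omega_limit :: "(real^'n) set \<Rightarrow> (real \<Rightarrow> real^'n \<Rightarrow> real) \<Rightarrow> (real^'n \<Rightarrow> real) set" where
  "omega_limit \<Omega> u = {\<phi>. integrable (lebesgue_on \<Omega>) \<phi> \<and>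
     (\<exists>t :: nat \<Rightarrow> real. (\<forall>n. 0 \<le> t n) \<and> filterlim t at_top sequentially \<and>
        (\<lambda>n. \<integral>\<^sup>+ x. ennreal \<bar>u (t n) x - \<phi> x\<bar> \<partial>lebesgue_on \<Omega>) \<longlonglongrightarrow> 0)}"

text \<open>The interval integral is oriented, so it is the usual one for negative \<open>s\<close> as well.\<close>

definition primitive :: "(real \<Rightarrow> real) \<Rightarrow> real \<Rightarrow> real" where
  "primitive p s = (LBINT \<tau>=0..s. p \<tau>)"

definition E :: "(real^'n) set \<Rightarrow> (real \<Rightarrow> real) \<Rightarrow> nat \<Rightarrow> (real^'n \<Rightarrow> real) \<Rightarrow> real" where
  "E \<Omega> p i v = (-1) ^ (i + 1) * (LINT x|lebesgue_on \<Omega>. primitive p (v x))"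

end

theory Submission
  imports Defs "HOL-Probability.Helly_Selection" "HOL-Complex_Analysis.Great_Picard"
begin

text \<open>Since \<open>\<lambda>(t) = \<integral> g(u) p(u) / \<integral> g(u)\<close> depends on time only, all values \<open>u(t,x)\<close> obey the same
  scalar equation \<open>y' = g(y) (p(y) - \<lambda>(t))\<close>. Comparing Euler polygons of step \<open>T/N\<close>, whose consistency
  error is uniform almost everywhere because \<open>u\<close> is \<open>C\<^sup>1\<close> into \<open>L\<^sup>\<infinity>\<close>, shows that \<open>u(t,x)\<close> is a
  nondecreasing Lipschitz function of \<open>u\<^sub>0(x)\<close> and that the zeros \<open>0\<close> and \<open>1\<close> of \<open>g\<close> are barriers.
  As long as \<open>g(u)\<close> has a constant sign \<open>\<sigma>\<close>, \<open>\<lambda>\<close> is a weighted mean of \<open>p(u)\<close>, which confines \<open>u\<close> to a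
  compact interval. Helly's theorem then yields a limit point in \<open>L\<^sup>1\<close>.
  With \<open>P' = p\<close>, the derivative of \<open>- \<sigma> \<integral> P(u)\<close> is \<open>- \<sigma> \<integral> g(u) (p(u) - \<lambda>)\<^sup>2 \<le> 0\<close>, so this functional converges; since
  \<open>u\<close> is Lipschitz in time, every limit point is also reached along times at which the dissipation
  tends to zero, and dominated convergence gives \<open>g(\<phi>) (p(\<phi>) - \<lambda>) = 0\<close> whenever \<open>\<integral> g(\<phi>) \<noteq> 0\<close>.\<close>

section \<open>Differentiable curves in the space of bounded functions\<close>

lemma Linf_AE_bounded:
  assumes "f \<in> Linf M"
  obtains c where "c \<ge> 0" "AE x in M. \<bar>f x\<bar> \<le> c"
proof -
  have *: "Linf_norm M f < \<infinity>" using assms by (simp add: Linf_def)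
  show thesis
  proof (rule that)
    show "enn2real (Linf_norm M f) \<ge> 0" by simp
    have "AE x in M. ennreal \<bar>f x\<bar> \<le> Linf_norm M f"
      unfolding Linf_norm_def by (rule esssup_AE)
    then show "AE x in M. \<bar>f x\<bar> \<le> enn2real (Linf_norm M f)"
    proof eventually_elim
      case (elim x)
      then have "enn2real (ennreal \<bar>f x\<bar>) \<le> enn2real (Linf_norm M f)"
        using * by (intro enn2real_mono) auto
      then show ?case by simp
    qed
  qed
qed

lemma Linf_of_AE_bounded:
  assumes "f \<in> borel_measurable M" "AE x in M. \<bar>f x\<bar> \<le> c"
  shows "f \<in> Linf M"
proof -
  have "Linf_norm M f \<le> ennreal c"
    unfolding Linf_norm_def
    by (rule esssup_I) (use assms in \<open>auto elim: eventually_mono intro: ennreal_leI\<close>)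
  then show ?thesis using assms by (auto simp: Linf_def intro: le_less_trans)
qed

lemma Linf_norm_tendsto_0D:
  assumes "((\<lambda>s. Linf_norm M (f s)) \<longlongrightarrow> 0) G" "\<epsilon> > 0"
  shows "\<forall>\<^sub>F s in G. AE x in M. \<bar>f s x\<bar> \<le> \<epsilon>"
proof -
  have "\<forall>\<^sub>F s in G. Linf_norm M (f s) < ennreal \<epsilon>"
    using assms by (intro order_tendstoD) auto
  then show ?thesis
  proof eventually_elim
    case (elim s)
    have "AE x in M. ennreal \<bar>f s x\<bar> \<le> Linf_norm M (f s)"
      unfolding Linf_norm_def by (rule esssup_AE)
    then show ?case
    proof eventually_elim
      case (elim x)
      then have "ennreal \<bar>f s x\<bar> \<le> ennreal \<epsilon>"
        using \<open>Linf_norm M (f s) < ennreal \<epsilon>\<close> by simp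
      then show ?case using \<open>\<epsilon> > 0\<close> by (simp add: ennreal_le_iff)
    qed
  qed
qed

text \<open>Norm limits are unfolded into almost everywhere inequalities whose null set may depend
  on \<open>s\<close>, so a statement about the path of a single point \<open>x\<close> has to be
  reduced to countably many times. Clearing the denominator of the difference quotient makes the
  case \<open>s = t\<close> harmless.\<close>

locale C1_curve =
  fixes M :: "'a measure" and u u' :: "real \<Rightarrow> 'a \<Rightarrow> real"
  assumes meas [measurable]: "t \<ge> 0 \<Longrightarrow> u t \<in> borel_measurable M"
    and meas' [measurable]: "t \<ge> 0 \<Longrightarrow> u' t \<in> borel_measurable M"
    and bounded_at: "t \<ge> 0 \<Longrightarrow> \<exists>c. AE x in M. \<bar>u t x\<bar> \<le> c"
    and bounded_deriv_at: "t \<ge> 0 \<Longrightarrow> \<exists>c. AE x in M. \<bar>u' t x\<bar> \<le> c"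
    and deriv_at: "\<lbrakk>t \<ge> 0; \<epsilon> > 0\<rbrakk> \<Longrightarrow> \<exists>\<delta>>0. \<forall>s\<ge>0. \<bar>s - t\<bar> < \<delta> \<longrightarrow>
          (AE x in M. \<bar>u s x - u t x - (s - t) * u' t x\<bar> \<le> \<epsilon> * \<bar>s - t\<bar>)"
    and cont_deriv_at: "\<lbrakk>t \<ge> 0; \<epsilon> > 0\<rbrakk> \<Longrightarrow> \<exists>\<delta>>0. \<forall>s\<ge>0. \<bar>s - t\<bar> < \<delta> \<longrightarrow>
          (AE x in M. \<bar>u' s x - u' t x\<bar> \<le> \<epsilon>)"

lemma C1_curve_if_C1_Linf_on:
  assumes "C1_Linf_on M {0..} u u'"
  shows "C1_curve M u u'"
proof
  fix t :: real assume t: "t \<ge> 0"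
  have in_Linf: "u t \<in> Linf M" "u' t \<in> Linf M"
    and deriv: "((\<lambda>s. Linf_norm M (\<lambda>x. (u s x - u t x) / (s - t) - u' t x)) \<longlongrightarrow> 0) (at t within {0..})"
    and cont: "((\<lambda>s. Linf_norm M (\<lambda>x. u' s x - u' t x)) \<longlongrightarrow> 0) (at t within {0..})"
    using assms t by (auto simp: C1_Linf_on_def)
  show "u t \<in> borel_measurable M" "u' t \<in> borel_measurable M"
    using in_Linf by (auto simp: Linf_def)
  show "\<exists>c. AE x in M. \<bar>u t x\<bar> \<le> c" "\<exists>c. AE x in M. \<bar>u' t x\<bar> \<le> c"
    using in_Linf Linf_AE_bounded by metis+
  fix \<epsilon> :: real assume \<epsilon>: "\<epsilon> > 0"
  obtain \<delta> where "\<delta> > 0" and \<delta>: "\<And>s. \<lbrakk>s \<ge> 0; s \<noteq> t; \<bar>s - t\<bar> < \<delta>\<rbrakk> \<Longrightarrow>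
      AE x in M. \<bar>(u s x - u t x) / (s - t) - u' t x\<bar> \<le> \<epsilon>"
    using Linf_norm_tendsto_0D[OF deriv \<epsilon>] by (auto simp: eventually_at dist_real_def)
  have "AE x in M. \<bar>u s x - u t x - (s - t) * u' t x\<bar> \<le> \<epsilon> * \<bar>s - t\<bar>" if "s \<ge> 0" "\<bar>s - t\<bar> < \<delta>" for s
  proof (cases "s = t")
    case False
    from \<delta>[OF that(1) False that(2)] show ?thesis
    proof eventually_elim
      case (elim x)
      have "\<bar>u s x - u t x - (s - t) * u' t x\<bar> = \<bar>(u s x - u t x) / (s - t) - u' t x\<bar> * \<bar>s - t\<bar>"
        using False by (simp add: abs_mult[symmetric] field_simps)
      also have "\<dots> \<le> \<epsilon> * \<bar>s - t\<bar>" using elim by (intro mult_right_mono) auto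
      finally show ?case .
    qed
  qed simp
  then show "\<exists>\<delta>>0. \<forall>s\<ge>0. \<bar>s - t\<bar> < \<delta> \<longrightarrow>
      (AE x in M. \<bar>u s x - u t x - (s - t) * u' t x\<bar> \<le> \<epsilon> * \<bar>s - t\<bar>)"
    using \<open>\<delta> > 0\<close> by blast
  obtain \<delta>' where "\<delta>' > 0" and \<delta>': "\<And>s. \<lbrakk>s \<ge> 0; s \<noteq> t; \<bar>s - t\<bar> < \<delta>'\<rbrakk> \<Longrightarrow>
      AE x in M. \<bar>u' s x - u' t x\<bar> \<le> \<epsilon>"
    using Linf_norm_tendsto_0D[OF cont \<epsilon>] by (auto simp: eventually_at dist_real_def)
  have "AE x in M. \<bar>u' s x - u' t x\<bar> \<le> \<epsilon>" if "s \<ge> 0" "\<bar>s - t\<bar> < \<delta>'" for s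
    using \<delta>'[of s] that \<epsilon> by (cases "s = t") auto
  then show "\<exists>\<delta>>0. \<forall>s\<ge>0. \<bar>s - t\<bar> < \<delta> \<longrightarrow> (AE x in M. \<bar>u' s x - u' t x\<bar> \<le> \<epsilon>)"
    using \<open>\<delta>' > 0\<close> by blast
qed

section \<open>Mean value inequality, uniform differentiability and a maximum principle\<close>

context C1_curve
begin

text \<open>Bisection replaces the pointwise mean value theorem, because null sets vary with time:
  the inequality adds up over adjacent intervals, and differentiability gives it on short intervals
  around each \<open>t\<close> at the price of the slack \<open>\<epsilon>\<close>.\<close>

lemma mean_value:
  assumes "0 \<le> a" "a \<le> b" "\<epsilon> > 0"
    and bound: "\<And>t. a \<le> t \<Longrightarrow> t \<le> b \<Longrightarrow> AE x in M. \<bar>u' t x - w x\<bar> \<le> C"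
  shows "AE x in M. \<bar>u b x - u a x - (b - a) * w x\<bar> \<le> (C + \<epsilon>) * (b - a)"
proof -
  define P where "P s t \<longleftrightarrow> (a \<le> s \<and> s \<le> t \<and> t \<le> b \<longrightarrow>
      (AE x in M. \<bar>u t x - u s x - (t - s) * w x\<bar> \<le> (C + \<epsilon>) * (t - s)))" for s t
  have "P a b" using \<open>a \<le> b\<close>
  proof (induction rule: Bolzano)
    case (trans s t r)
    show ?case unfolding P_def
    proof (intro impI)
      assume "a \<le> s \<and> s \<le> r \<and> r \<le> b"
      then have "AE x in M. \<bar>u t x - u s x - (t - s) * w x\<bar> \<le> (C + \<epsilon>) * (t - s)"
        "AE x in M. \<bar>u r x - u t x - (r - t) * w x\<bar> \<le> (C + \<epsilon>) * (r - t)"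
        using trans by (auto simp: P_def)
      then show "AE x in M. \<bar>u r x - u s x - (r - s) * w x\<bar> \<le> (C + \<epsilon>) * (r - s)"
      proof eventually_elim
        case (elim x)
        have "(C + \<epsilon>) * (r - s) = (C + \<epsilon>) * (t - s) + (C + \<epsilon>) * (r - t)"
          "u r x - u s x - (r - s) * w x = (u t x - u s x - (t - s) * w x) + (u r x - u t x - (r - t) * w x)"
          by (simp_all add: algebra_simps)
        then show ?case using elim by linarith
      qed
    qed
  next
    case (local t)
    then have "t \<ge> 0" using assms by simp
    from deriv_at[OF this \<open>\<epsilon> > 0\<close>] obtain \<delta> where "\<delta> > 0" and \<delta>: "\<And>s. \<lbrakk>s \<ge> 0; \<bar>s - t\<bar> < \<delta>\<rbrakk> \<Longrightarrow>
        AE x in M. \<bar>u s x - u t x - (s - t) * u' t x\<bar> \<le> \<epsilon> * \<bar>s - t\<bar>" by blast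
    have near: "AE x in M. \<bar>u s x - u t x - (s - t) * w x\<bar> \<le> (C + \<epsilon>) * \<bar>s - t\<bar>"
      if "s \<ge> 0" "\<bar>s - t\<bar> < \<delta>" for s
      using \<delta>[OF that] bound[OF local]
    proof eventually_elim
      case (elim x)
      have "u s x - u t x - (s - t) * w x = (u s x - u t x - (s - t) * u' t x) + (s - t) * (u' t x - w x)"
        by (simp add: algebra_simps)
      moreover have "\<bar>(s - t) * (u' t x - w x)\<bar> \<le> C * \<bar>s - t\<bar>"
        unfolding abs_mult mult.commute[of C]
        using elim by (intro mult_left_mono) auto
      ultimately show ?case using elim(1) by (simp add: algebra_simps)
    qed
    \<comment> \<open>A short interval around \<open>t\<close> is split at \<open>t\<close>, and
      both halves are estimated from there.\<close>
    have "P r s" if "r \<le> t" "t \<le> s" "s - r < \<delta>" for r s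
      unfolding P_def
    proof (intro impI)
      assume rs: "a \<le> r \<and> r \<le> s \<and> s \<le> b"
      show "AE x in M. \<bar>u s x - u r x - (s - r) * w x\<bar> \<le> (C + \<epsilon>) * (s - r)"
      proof -
        have "AE x in M. \<bar>u s x - u t x - (s - t) * w x\<bar> \<le> (C + \<epsilon>) * \<bar>s - t\<bar>"
          "AE x in M. \<bar>u r x - u t x - (r - t) * w x\<bar> \<le> (C + \<epsilon>) * \<bar>r - t\<bar>"
          using rs that assms by (intro near; simp)+
        then show ?thesis
        proof eventually_elim
          case (elim x)
          have "(C + \<epsilon>) * (s - r) = (C + \<epsilon>) * \<bar>s - t\<bar> + (C + \<epsilon>) * \<bar>r - t\<bar>"
            "u s x - u r x - (s - r) * w x = (u s x - u t x - (s - t) * w x) - (u r x - u t x - (r - t) * w x)"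
            using that by (simp_all add: algebra_simps)
          then show ?case using elim by linarith
        qed
      qed
    qed
    then show ?case using \<open>\<delta> > 0\<close> by (intro exI[of _ \<delta>]) simp
  qed
  then show ?thesis using assms by (simp add: P_def)
qed

text \<open>Compactness of \<open>[0, T]\<close>, again by bisection: near each time the linear
  approximation bounds \<open>u\<close>, and bounds on adjacent intervals combine to their
  maximum.\<close>

lemma AE_bounded_on:
  assumes "0 \<le> T"
  shows "\<exists>R. \<forall>t. 0 \<le> t \<and> t \<le> T \<longrightarrow> (AE x in M. \<bar>u t x\<bar> \<le> R)"
proof -
  define P where "P a b \<longleftrightarrow> (\<exists>R. \<forall>t. 0 \<le> t \<and> a \<le> t \<and> t \<le> b \<longrightarrow> (AE x in M. \<bar>u t x\<bar> \<le> R))" for a b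
  have "P 0 T" using \<open>0 \<le> T\<close>
  proof (induction rule: Bolzano)
    case (trans a b c)
    then obtain R R' where R: "\<And>t. \<lbrakk>0 \<le> t; a \<le> t; t \<le> b\<rbrakk> \<Longrightarrow> AE x in M. \<bar>u t x\<bar> \<le> R"
      "\<And>t. \<lbrakk>0 \<le> t; b \<le> t; t \<le> c\<rbrakk> \<Longrightarrow> AE x in M. \<bar>u t x\<bar> \<le> R'" unfolding P_def by metis
    have "AE x in M. \<bar>u t x\<bar> \<le> max R R'" if "0 \<le> t" "a \<le> t" "t \<le> c" for t
      using R(1)[of t] R(2)[of t] that by (cases "t \<le> b") (auto elim: eventually_mono)
    then show ?case unfolding P_def by blast
  next
    case (local t)
    obtain c c' where c: "AE x in M. \<bar>u t x\<bar> \<le> c" "AE x in M. \<bar>u' t x\<bar> \<le> c'"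
      using bounded_at bounded_deriv_at local by meson
    obtain \<delta> where "\<delta> > 0" and \<delta>: "\<And>s. \<lbrakk>s \<ge> 0; \<bar>s - t\<bar> < \<delta>\<rbrakk> \<Longrightarrow>
        AE x in M. \<bar>u s x - u t x - (s - t) * u' t x\<bar> \<le> 1 * \<bar>s - t\<bar>"
      using deriv_at[of t 1] local by force
    have "AE x in M. \<bar>u s x\<bar> \<le> c + \<delta> * (1 + c')" if "s \<ge> 0" "\<bar>s - t\<bar> < \<delta>" for s
      using c \<delta>[OF that]
    proof eventually_elim
      case (elim x)
      have "\<bar>(s - t) * u' t x\<bar> \<le> \<delta> * c'"
        unfolding abs_mult using that elim by (intro mult_mono) auto
      then show ?case using elim that by (simp add: algebra_simps)
    qed
    moreover have "\<bar>s - t\<bar> < \<delta>" if "a \<le> t" "t \<le> b" "b - a < \<delta>" "a \<le> s" "s \<le> b" for a b s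
      using that by linarith
    ultimately show ?case unfolding P_def using \<open>\<delta> > 0\<close>
      by (intro exI[of _ \<delta>] conjI allI impI exI[of _ "c + \<delta> * (1 + c')"]) auto
  qed
  then show ?thesis by (auto simp: P_def)
qed

lemma uniform_deriv:
  assumes "\<epsilon> > 0"
  shows "\<exists>\<delta>>0. \<forall>s t. 0 \<le> s \<and> s \<le> t \<and> t \<le> T \<and> t - s < \<delta> \<longrightarrow>
          (AE x in M. \<bar>u t x - u s x - (t - s) * u' s x\<bar> \<le> \<epsilon> * (t - s))"
proof -
  have "\<forall>t\<in>{0..T}. \<exists>\<delta>>0. \<forall>s\<ge>0. \<bar>s - t\<bar> < \<delta> \<longrightarrow> (AE x in M. \<bar>u' s x - u' t x\<bar> \<le> \<epsilon> / 4)"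
    using cont_deriv_at[where \<epsilon> = "\<epsilon> / 4"] assms by simp
  from bchoice[OF this] obtain d where "\<forall>t\<in>{0..T}. d t > 0 \<and>
      (\<forall>s\<ge>0. \<bar>s - t\<bar> < d t \<longrightarrow> (AE x in M. \<bar>u' s x - u' t x\<bar> \<le> \<epsilon> / 4))" ..
  then have d: "\<And>t. t \<in> {0..T} \<Longrightarrow> d t > 0"
    "\<And>t s. \<lbrakk>t \<in> {0..T}; s \<ge> 0; \<bar>s - t\<bar> < d t\<rbrakk> \<Longrightarrow> AE x in M. \<bar>u' s x - u' t x\<bar> \<le> \<epsilon> / 4"
    by auto
  \<comment> \<open>\<open>\<delta>\<close> is a Lebesgue number of the cover: two times closer than
    \<open>\<delta>\<close> lie in one ball, so their deviations \<open>\<epsilon> / 4\<close> from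
    its centre add up to \<open>\<epsilon> / 2\<close>; the other \<open>\<epsilon> / 2\<close> is
    the slack of \<open>mean_value\<close>.\<close>
  obtain \<delta> where "\<delta> > 0" and
    \<delta>: "\<And>t. t \<in> {0..T} \<Longrightarrow> \<exists>G \<in> (\<lambda>t. ball t (d t)) ` {0..T}. ball t \<delta> \<subseteq> G"
    by (rule Heine_Borel_lemma[of "{0..T}" "(\<lambda>t. ball t (d t)) ` {0..T}"]) (use d(1) in auto)
  have close: "AE x in M. \<bar>u' t x - u' s x\<bar> \<le> \<epsilon> / 2" if "s \<in> {0..T}" "t \<ge> 0" "\<bar>t - s\<bar> < \<delta>" for s t
  proof -
    from \<delta>[OF that(1)] obtain r where r: "r \<in> {0..T}" "ball s \<delta> \<subseteq> ball r (d r)" by auto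
    moreover have "s \<in> ball s \<delta>" "t \<in> ball s \<delta>" using that \<open>\<delta> > 0\<close> by (auto simp: dist_real_def)
    ultimately have "s \<in> ball r (d r)" "t \<in> ball r (d r)" by blast+
    then have "AE x in M. \<bar>u' s x - u' r x\<bar> \<le> \<epsilon> / 4" "AE x in M. \<bar>u' t x - u' r x\<bar> \<le> \<epsilon> / 4"
      using that r by (intro d(2); simp add: dist_real_def abs_minus_commute)+
    then show ?thesis by eventually_elim linarith
  qed
  show ?thesis
  proof (intro exI[of _ \<delta>] conjI allI impI \<open>\<delta> > 0\<close>)
    fix s t assume st: "0 \<le> s \<and> s \<le> t \<and> t \<le> T \<and> t - s < \<delta>"
    have "AE x in M. \<bar>u t x - u s x - (t - s) * u' s x\<bar> \<le> (\<epsilon> / 2 + \<epsilon> / 2) * (t - s)"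
      by (rule mean_value; (rule close)?; use st assms in simp)
    then show "AE x in M. \<bar>u t x - u s x - (t - s) * u' s x\<bar> \<le> \<epsilon> * (t - s)" by simp
  qed
qed

text \<open>Carries upper bounds over to lower bounds.\<close>

lemma C1_curve_uminus: "C1_curve M (\<lambda>t x. - u t x) (\<lambda>t x. - u' t x)"
proof
  fix t \<epsilon> :: real assume "t \<ge> 0" "\<epsilon> > 0"
  have "\<bar>- a - - b - c * - d\<bar> = \<bar>a - b - c * d\<bar>" "\<bar>- a - - b\<bar> = \<bar>a - b\<bar>" for a b c d :: real
    by (auto simp: abs_if)
  then show "\<exists>\<delta>>0. \<forall>s\<ge>0. \<bar>s - t\<bar> < \<delta> \<longrightarrow>
      (AE x in M. \<bar>- u s x - - u t x - (s - t) * - u' t x\<bar> \<le> \<epsilon> * \<bar>s - t\<bar>)"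
    "\<exists>\<delta>>0. \<forall>s\<ge>0. \<bar>s - t\<bar> < \<delta> \<longrightarrow> (AE x in M. \<bar>- u' s x - - u' t x\<bar> \<le> \<epsilon>)"
    using deriv_at[OF \<open>t \<ge> 0\<close> \<open>\<epsilon> > 0\<close>] cont_deriv_at[OF \<open>t \<ge> 0\<close> \<open>\<epsilon> > 0\<close>] by simp_all
qed (use bounded_at bounded_deriv_at in auto)

text \<open>A discrete maximum principle: along an Euler grid of mesh \<open>h\<close> the bound \<open>c\<close> grows by at most
  \<open>\<epsilon> h\<close> per step as soon as \<open>K h \<le> 1\<close>.\<close>

lemma AE_upper_bound:
  assumes "0 \<le> T" "K \<ge> 0" and init: "AE x in M. u 0 x \<le> B"
    and inward: "\<And>t c. \<lbrakk>0 \<le> t; t \<le> T; B \<le> c; c \<le> B + 1; AE x in M. u t x \<le> c\<rbrakk> \<Longrightarrow>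
        AE x in M. u' t x \<le> K * (c - u t x)"
  shows "AE x in M. u T x \<le> B"
proof -
  \<comment> \<open>Each step may add \<open>\<epsilon> * h\<close>, in total
    \<open>\<epsilon> * T\<close>; the restriction \<open>\<epsilon> * T \<le> 1\<close> keeps the
    current level inside \<open>[B, B + 1]\<close>, where \<open>inward\<close> applies.\<close>
  have approx: "AE x in M. u T x \<le> B + \<epsilon> * T" if \<epsilon>: "\<epsilon> > 0" "\<epsilon> * T \<le> 1" for \<epsilon>
  proof -
    obtain \<delta> where "\<delta> > 0" and \<delta>: "\<And>s t. \<lbrakk>0 \<le> s; s \<le> t; t \<le> T; t - s < \<delta>\<rbrakk> \<Longrightarrow>
          AE x in M. \<bar>u t x - u s x - (t - s) * u' s x\<bar> \<le> \<epsilon> * (t - s)"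
      using uniform_deriv[OF \<epsilon>(1), of T] by blast
    obtain n :: nat where n: "real n > max (T / \<delta>) (K * T)" using reals_Archimedean2 by blast
    have "max (T / \<delta>) (K * T) \<ge> 0" using assms(1,2) \<open>\<delta> > 0\<close> by (simp add: le_max_iff_disj)
    then have "n > 0" using n by (cases n) auto
    define h where "h = T / n"
    have h: "h \<ge> 0" "h < \<delta>" "K * h \<le> 1" "n * h = T"
      using n \<open>n > 0\<close> \<open>0 \<le> T\<close> \<open>\<delta> > 0\<close> by (auto simp: h_def field_simps)
    have "AE x in M. u (k * h) x \<le> B + \<epsilon> * (k * h)" if "k \<le> n" for k :: nat
      using that
    proof (induction k)
      case 0
      then show ?case using init by simp
    next
      case (Suc k)
      define s t where "s = k * h" and "t = Suc k * h"
      have kn: "k * h \<le> T" "Suc k * h \<le> T" unfolding h(4)[symmetric] using Suc.prems h(1)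
        by (intro mult_right_mono; simp)+
      have st: "0 \<le> s" "s \<le> t" "t \<le> T" "t - s = h" "s \<le> T" using h(1) kn
        by (auto simp: s_def t_def algebra_simps)
      define c where "c = B + \<epsilon> * s"
      have "\<epsilon> * s \<le> \<epsilon> * T" "\<epsilon> * s \<ge> 0" using st \<epsilon> by (auto intro: mult_left_mono)
      then have c: "B \<le> c" "c \<le> B + 1" unfolding c_def using \<epsilon>(2) by linarith+
      have IH: "AE x in M. u s x \<le> c" using Suc by (simp add: s_def c_def)
      have "AE x in M. u' s x \<le> K * (c - u s x)"
        by (rule inward) (use st c IH in auto)
      moreover have "AE x in M. \<bar>u t x - u s x - (t - s) * u' s x\<bar> \<le> \<epsilon> * (t - s)"
        by (rule \<delta>) (use st h in auto)
      ultimately have "AE x in M. u t x \<le> c + \<epsilon> * h" using IH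
      proof eventually_elim
        case (elim x)
        \<comment> \<open>Since \<open>K * h \<le> 1\<close>, one Euler step from a value below
          \<open>c\<close> cannot pass \<open>c\<close>.\<close>
        have "h * u' s x \<le> h * (K * (c - u s x))" using elim(1) h(1) by (rule mult_left_mono)
        also have "\<dots> = (K * h) * (c - u s x)" by simp
        also have "\<dots> \<le> 1 * (c - u s x)" by (rule mult_right_mono) (use elim h in auto)
        finally have "h * u' s x \<le> c - u s x" by simp
        moreover have "u t x - u s x - h * u' s x \<le> \<epsilon> * h"
          using elim(2) unfolding st(4) by (rule abs_le_D1)
        ultimately show ?case by linarith
      qed
      then show ?case by (simp add: c_def s_def t_def algebra_simps)
    qed
    from this[of n] show ?thesis using h by simp
  qed
  have "AE x in M. \<forall>k. u T x \<le> B + 1 / real (Suc k)"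
    unfolding AE_all_countable
  proof
    fix k
    show "AE x in M. u T x \<le> B + 1 / real (Suc k)"
    proof (cases "T = 0")
      case True
      from init show ?thesis unfolding True by eventually_elim (simp add: add_increasing2)
    next
      case False
      then have "T > 0" using \<open>0 \<le> T\<close> by simp
      \<comment> \<open>This \<open>\<epsilon>\<close> makes the accumulated error
        \<open>\<epsilon> * T\<close> equal to \<open>1 / (k + 1)\<close>, which is at most 1 as
        \<open>approx\<close> requires.\<close>
      then have "AE x in M. u T x \<le> B + (1 / (Suc k * T)) * T"
        by (intro approx) auto
      then show ?thesis using \<open>T > 0\<close> by simp
    qed
  qed
  then show ?thesis
  proof eventually_elim
    case (elim x)
    then show ?case using LIMSEQ_le_const[of "\<lambda>k. B + 1 / real (Suc k)" "B + 0" "u T x"]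
        tendsto_add[OF tendsto_const LIMSEQ_Suc[OF lim_1_over_n]] by auto
  qed
qed

end

section \<open>Euler polygons and Helly selection\<close>

text \<open>Consistency with the Euler scheme, asked only at the grid times
  \<open>k * (T / N)\<close>. These are countably many, so the property can be established for
  almost every \<open>x\<close> at once.\<close>

definition euler_exact :: "(real \<Rightarrow> real \<Rightarrow> real) \<Rightarrow> real \<Rightarrow> (real \<Rightarrow> real) \<Rightarrow> bool" where
  "euler_exact f T y \<longleftrightarrow> (\<forall>\<epsilon>>0. \<forall>\<^sub>F N in sequentially. \<forall>k<N.
     \<bar>y (Suc k * (T / N)) - y (k * (T / N)) - T / N * f (k * (T / N)) (y (k * (T / N)))\<bar> \<le> \<epsilon> * (T / N))"

text \<open>A discrete Gronwall estimate. Working with the positive part of \<open>y - z\<close>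
  yields order preservation and Lipschitz dependence on the initial value together.\<close>

lemma euler_exact_comparison:
  assumes "T \<ge> 0" "L \<ge> 0"
    and lip: "\<And>t a b. \<lbrakk>0 \<le> t; t \<le> T; \<bar>a\<bar> \<le> R; \<bar>b\<bar> \<le> R\<rbrakk> \<Longrightarrow> \<bar>f t a - f t b\<bar> \<le> L * \<bar>a - b\<bar>"
    and y: "euler_exact f T y" "\<And>N k. k \<le> N \<Longrightarrow> \<bar>y (real k * (T / real N))\<bar> \<le> R"
    and z: "euler_exact f T z" "\<And>N k. k \<le> N \<Longrightarrow> \<bar>z (real k * (T / real N))\<bar> \<le> R"
  shows "max 0 (y T - z T) \<le> exp (L * T) * max 0 (y 0 - z 0)"
proof (rule field_le_epsilon)
  fix e :: real assume "e > 0"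
  \<comment> \<open>Chosen so that the accumulated residuals of both curves,
    \<open>2 * exp (L * T) * \<epsilon> * T\<close>, are at most \<open>e\<close>;
    \<open>T + 1\<close> keeps the denominator positive when \<open>T = 0\<close>.\<close>
  define \<epsilon> where "\<epsilon> = e / (2 * exp (L * T) * (T + 1))"
  have "\<epsilon> > 0" using \<open>e > 0\<close> \<open>T \<ge> 0\<close> by (simp add: \<epsilon>_def)
  have "\<forall>\<^sub>F N in sequentially. real N > L * T"
    using filterlim_real_sequentially by (simp add: filterlim_at_top_dense)
  from eventually_happens'[OF sequentially_bot eventually_conj[OF this eventually_conj[OF
        y(1)[unfolded euler_exact_def, rule_format, OF \<open>\<epsilon> > 0\<close>]
        z(1)[unfolded euler_exact_def, rule_format, OF \<open>\<epsilon> > 0\<close>]]]]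
  obtain N where N: "real N > L * T"
    and yN: "\<And>k. k < N \<Longrightarrow> \<bar>y (Suc k * (T / N)) - y (k * (T / N)) - T / N * f (k * (T / N)) (y (k * (T / N)))\<bar> \<le> \<epsilon> * (T / N)"
    and zN: "\<And>k. k < N \<Longrightarrow> \<bar>z (Suc k * (T / N)) - z (k * (T / N)) - T / N * f (k * (T / N)) (z (k * (T / N)))\<bar> \<le> \<epsilon> * (T / N)"
    by auto
  have "L * T \<ge> 0" using assms by simp
  then have "N > 0" using N by (cases N) auto
  define h where "h = T / N"
  have h: "h \<ge> 0" "L * h \<le> 1" "N * h = T"
    using N \<open>N > 0\<close> \<open>T \<ge> 0\<close> by (auto simp: h_def field_simps)
  define w where "w k = max 0 (y (real k * h) - z (real k * h))" for k :: nat
  have step: "w (Suc k) \<le> (1 + L * h) * w k + 2 * \<epsilon> * h" if "k < N" for k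
  proof -
    define a b where "a = y (real k * h)" and "b = z (real k * h)"
    have "real k * h \<le> N * h" using that h(1) by (intro mult_right_mono) auto
    then have "\<bar>f (real k * h) a - f (real k * h) b\<bar> \<le> L * \<bar>a - b\<bar>"
      unfolding a_def b_def using y(2)[of k N, folded h_def] z(2)[of k N, folded h_def] that h
      by (intro lip) auto
    then have "\<bar>h * (f (real k * h) a - f (real k * h) b)\<bar> \<le> h * (L * \<bar>a - b\<bar>)"
      using h(1) by (simp add: abs_mult mult_left_mono)
    then have diff: "\<bar>h * f (real k * h) a - h * f (real k * h) b\<bar> \<le> L * h * \<bar>a - b\<bar>"
      by (simp add: algebra_simps)
    have yz: "\<bar>y (real (Suc k) * h) - a - h * f (real k * h) a\<bar> \<le> \<epsilon> * h"
      "\<bar>z (real (Suc k) * h) - b - h * f (real k * h) b\<bar> \<le> \<epsilon> * h"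
      using yN[OF that] zN[OF that] unfolding a_def b_def h_def by auto
    have pos: "\<epsilon> * h \<ge> 0" "L * h * \<bar>a - b\<bar> \<ge> 0" using \<open>\<epsilon> > 0\<close> h(1) \<open>L \<ge> 0\<close> by auto
    have w: "w k = max 0 (a - b)" "w (Suc k) = max 0 (y (real (Suc k) * h) - z (real (Suc k) * h))"
      by (simp_all add: w_def a_def b_def)
    show ?thesis
    proof (cases "a \<ge> b")
      case True
      then have "w k = a - b" and "\<bar>a - b\<bar> = a - b" by (auto simp: w)
      then have "(1 + L * h) * w k = a - b + L * h * \<bar>a - b\<bar>" by (simp only: distrib_right mult_1)
      then show ?thesis using diff yz pos True unfolding w(2) by linarith
    next
      case False
      then have "w k = 0" by (simp add: w)
      \<comment> \<open>When \<open>y\<close> starts the step below \<open>z\<close>,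
        \<open>L * h \<le> 1\<close> prevents the exact Euler steps from crossing; only the
        residuals contribute to the positive part.\<close>
      have "h * f (real k * h) a - h * f (real k * h) b \<le> L * h * \<bar>a - b\<bar>"
        using diff by (rule abs_le_D1)
      also have "\<dots> \<le> 1 * \<bar>a - b\<bar>" using h(2) by (intro mult_right_mono) auto
      also have "\<dots> = b - a" using False by simp
      finally have "h * f (real k * h) a - h * f (real k * h) b \<le> b - a" .
      then have "w (Suc k) \<le> 2 * (\<epsilon> * h)" using yz pos(1) unfolding w(2) by linarith
      then show ?thesis using \<open>w k = 0\<close> by simp
    qed
  qed
  \<comment> \<open>The factor \<open>1 + L * h\<close> is absorbed into \<open>exp (L * h)\<close>;
    the residuals, \<open>2 * \<epsilon> * h\<close> per step, are collected in the second
    summand.\<close>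
  have "w k \<le> exp (L * h * k) * (w 0 + 2 * \<epsilon> * h * k)" if "k \<le> N" for k
    using that
  proof (induction k)
    case (Suc k)
    have pos: "2 * \<epsilon> * h \<ge> 0" "w 0 \<ge> 0" using \<open>\<epsilon> > 0\<close> h(1) by (auto simp: w_def)
    define q where "q = exp (L * h * k) * (w 0 + 2 * \<epsilon> * h * k)"
    have "q \<ge> 0" using pos by (simp add: q_def)
    have "w (Suc k) \<le> (1 + L * h) * w k + 2 * \<epsilon> * h" using step Suc by simp
    also have "\<dots> \<le> (1 + L * h) * q + 2 * \<epsilon> * h"
      using Suc h(1) \<open>L \<ge> 0\<close> unfolding q_def by (intro add_right_mono mult_left_mono) auto
    also have "\<dots> \<le> exp (L * h) * q + exp (L * h * Suc k) * (2 * \<epsilon> * h)"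
    proof (intro add_mono mult_right_mono)
      have "1 \<le> exp (L * h * Suc k)" using h(1) \<open>L \<ge> 0\<close> by simp
      from mult_right_mono[OF this pos(1)] show "2 * \<epsilon> * h \<le> exp (L * h * Suc k) * (2 * \<epsilon> * h)" by simp
    qed (use \<open>q \<ge> 0\<close> exp_ge_add_one_self in auto)
    also have "\<dots> = exp (L * h * Suc k) * (w 0 + 2 * \<epsilon> * h * Suc k)"
      by (simp add: q_def exp_add algebra_simps)
    finally show ?case .
  qed (simp add: w_def)
  from this[of N] have "w N \<le> exp (L * T) * (w 0 + 2 * \<epsilon> * T)"
    using h(3) by (simp add: mult.assoc mult.commute[of h])
  also have "\<dots> = exp (L * T) * w 0 + (2 * exp (L * T) * \<epsilon>) * T"
    by (simp add: algebra_simps)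
  also have "\<dots> = exp (L * T) * w 0 + e * (T / (T + 1))"
    by (simp add: \<epsilon>_def)
  also have "\<dots> \<le> exp (L * T) * w 0 + e * 1"
    using \<open>T \<ge> 0\<close> \<open>e > 0\<close> by (intro add_left_mono mult_left_mono) auto
  finally show "max 0 (y T - z T) \<le> exp (L * T) * max 0 (y 0 - z 0) + e"
    using h(3) by (simp add: w_def)
qed

lemma euler_exact_const:
  assumes "T \<ge> 0" "\<And>t. f t c = 0"
  shows "euler_exact f T (\<lambda>_. c)"
  using assms by (auto simp: euler_exact_def)

text \<open>The hypothesis says that each \<open>v n\<close> is a nondecreasing Lipschitz function of \<open>h\<close>; its McShane
  extension makes Helly's theorem applicable. At the countably many jumps of the Helly limit,
  convergence requires passing to a further subsequence.\<close>

lemma Helly_selection_factored: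
  fixes v :: "nat \<Rightarrow> 'a \<Rightarrow> real" and h :: "'a \<Rightarrow> real"
  assumes ord: "\<And>n x y. \<lbrakk>x \<in> X; y \<in> X\<rbrakk> \<Longrightarrow> max 0 (v n x - v n y) \<le> K n * max 0 (h x - h y)"
    and K: "\<And>n. K n \<ge> 0"
    and bdd: "\<And>n x. x \<in> X \<Longrightarrow> \<bar>v n x\<bar> \<le> B"
  shows "\<exists>r :: nat \<Rightarrow> nat. strict_mono r \<and> (\<forall>x\<in>X. convergent (\<lambda>k. v (r k) x))"
proof (cases "X = {}")
  case True
  then show ?thesis by (intro exI[of _ id]) (auto simp: strict_mono_def)
next
  case False
  then have "B \<ge> 0" using bdd by force
  \<comment> \<open>A one-sided McShane extension: the penalty \<open>max 0 (s - h y)\<close> in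
    place of \<open>\<bar>s - h y\<bar>\<close> makes the infimum nondecreasing in \<open>s\<close>.
    By \<open>ord\<close> the infimum at \<open>s = h x\<close> is attained by \<open>y = x\<close>,
    so \<open>v n x\<close> is recovered.\<close>
  define e where "e n y s = v n y + K n * max 0 (s - h y)" for n y s
  define G where "G n s = (INF y\<in>X. e n y s)" for n s
  \<comment> \<open>The infimum is at least \<open>- B\<close> already; cutting it at
    \<open>B\<close> gives the uniform bound that Helly's theorem needs, without changing the values
    at \<open>h x\<close> for \<open>x\<close> in \<open>X\<close>.\<close>
  define f where "f n s = min B (G n s)" for n s
  have e_ge: "e n y s \<ge> - B" if "y \<in> X" for n y s
  proof -
    have "v n y \<ge> - B" "K n * max 0 (s - h y) \<ge> 0" using bdd[OF that, of n] K[of n] by auto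
    then show ?thesis by (simp add: e_def)
  qed
  then have below: "bdd_below ((\<lambda>y. e n y s) ` X)" for n s by (intro bdd_belowI2)
  have G_ge: "G n s \<ge> - B" for n s
    unfolding G_def using False e_ge by (intro cINF_greatest) auto
  have e_Lip: "e n y s \<le> e n y t + K n * max 0 (s - t)" for n y s t
  proof -
    have "max 0 (s - h y) \<le> max 0 (t - h y) + max 0 (s - t)" by auto
    from mult_left_mono[OF this K[of n]] show ?thesis by (simp add: e_def algebra_simps)
  qed
  have G_Lip: "G n s \<le> G n t + K n * max 0 (s - t)" for n s t
  proof -
    have "G n s - K n * max 0 (s - t) \<le> e n y t" if "y \<in> X" for y
      using e_Lip[of n y s t] cINF_lower[OF below that, of n s] unfolding G_def by linarith
    then have "G n s - K n * max 0 (s - t) \<le> G n t"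
      unfolding G_def[of n t] using False by (intro cINF_greatest) auto
    then show ?thesis by simp
  qed
  have f_Lip: "f n s \<le> f n t + K n * max 0 (s - t)" for n s t
  proof -
    have "K n * max 0 (s - t) \<ge> 0" using K[of n] by simp
    then show ?thesis unfolding f_def using G_Lip[of n s t] by linarith
  qed
  have mono: "mono (f n)" for n
    proof
    fix s t :: real assume "s \<le> t"
    then show "f n s \<le> f n t" using f_Lip[of n s t] by (cases "s = t") (auto simp: max_def)
  qed
  have "(K n)-lipschitz_on UNIV (f n)" for n
  proof (rule lipschitz_onI)
    fix s t
    have "K n * max 0 (s - t) \<le> K n * \<bar>s - t\<bar>" "K n * max 0 (t - s) \<le> K n * \<bar>s - t\<bar>"
      using K[of n] by (auto intro!: mult_left_mono)
    then show "dist (f n s) (f n t) \<le> K n * dist s t"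
      using f_Lip[of n s t] f_Lip[of n t s] unfolding dist_real_def by linarith
  qed (rule K)
  then have cont: "continuous (at_right s) (f n)" for n s
    using lipschitz_on_continuous_on continuous_on_eq_continuous_at[OF open_UNIV]
      continuous_at_imp_continuous_at_within by blast
  have f_bdd: "\<bar>f n s\<bar> \<le> B" for n s
    using G_ge[of n s] \<open>B \<ge> 0\<close> unfolding f_def by linarith
  have f_h: "f n (h x) = v n x" if "x \<in> X" for n x
  proof -
    have "G n (h x) \<le> e n x (h x)" unfolding G_def by (rule cINF_lower[OF below that])
    moreover have "v n x \<le> e n y (h x)" if "y \<in> X" for y
      using ord[OF \<open>x \<in> X\<close> that, of n] by (simp add: e_def)
    then have "v n x \<le> G n (h x)" unfolding G_def using False by (intro cINF_greatest) auto
    moreover have "e n x (h x) = v n x" by (simp add: e_def)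
    ultimately show ?thesis using bdd[OF that, of n] unfolding f_def by linarith
  qed
  obtain s H where s: "strict_mono (s :: nat \<Rightarrow> nat)" and "mono H"
    and lim: "\<And>x. continuous (at x) H \<Longrightarrow> (\<lambda>n. f (s n) x) \<longlonglongrightarrow> H x"
    using Helly_selection[of f, OF cont mono f_bdd] by blast
  define D where "D = {x. \<not> continuous (at x) H}"
  have "countable D" unfolding D_def by (rule mono_ctble_discont[OF \<open>mono H\<close>])
  then obtain k where k: "strict_mono (k :: nat \<Rightarrow> nat)"
    and k_lim: "\<And>x. x \<in> D \<Longrightarrow> \<exists>l. (\<lambda>n. f (s (k n)) x) \<longlonglongrightarrow> l"
    using function_convergent_subsequence[of D "\<lambda>n. f (s n)" B] f_bdd by auto
  have conv: "convergent (\<lambda>n. f (s (k n)) t)" for t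
  proof (cases "t \<in> D")
    case False
    then show ?thesis using LIMSEQ_subseq_LIMSEQ[OF lim k, of t]
      by (auto simp: D_def convergent_def o_def)
  qed (use k_lim in \<open>auto simp: convergent_def\<close>)
  have "convergent (\<lambda>n. v (s (k n)) x)" if "x \<in> X" for x
    using conv[of "h x"] unfolding f_h[OF that] .
  then show ?thesis
    using strict_mono_o[OF s k] by (intro exI[of _ "s \<circ> k"]) auto
qed

section \<open>The nonlocal flow\<close>

lemma C1_locally_Lipschitz:
  fixes f :: "real \<Rightarrow> real"
  assumes "f C1_differentiable_on UNIV"
  shows "\<exists>L\<ge>0. \<forall>a b. \<bar>a\<bar> \<le> R \<longrightarrow> \<bar>b\<bar> \<le> R \<longrightarrow> \<bar>f a - f b\<bar> \<le> L * \<bar>a - b\<bar>"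
proof -
  obtain D where D: "\<And>x. (f has_real_derivative D x) (at x)" and cont: "continuous_on UNIV D"
    using assms by (auto simp: C1_differentiable_on_def has_real_derivative_iff_has_vector_derivative)
  have "compact (D ` {-R..R})"
    by (intro compact_continuous_image continuous_on_subset[OF cont]) auto
  then obtain L where L: "L > 0" "\<And>x. x \<in> {-R..R} \<Longrightarrow> \<bar>D x\<bar> \<le> L"
    using compact_imp_bounded[THEN bounded_pos[THEN iffD1]] by (metis imageI real_norm_def)
  have "\<bar>f a - f b\<bar> \<le> L * \<bar>a - b\<bar>" if "\<bar>a\<bar> \<le> R" "\<bar>b\<bar> \<le> R" for a b
    using field_differentiable_bound[of "{-R..R}" f D L a b] D L that
    by (auto intro: has_field_derivative_at_within simp: abs_le_iff minus_le_iff)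
  then show ?thesis using L(1) by (intro exI[of _ L]) auto
qed

lemma C1_continuous_on:
  fixes f :: "real \<Rightarrow> real"
  assumes "f C1_differentiable_on UNIV"
  shows "continuous_on S f"
  using C1_differentiable_imp_continuous_on[OF assms] continuous_on_subset by blast

lemma continuous_bounded_on_interval:
  fixes h :: "real \<Rightarrow> real"
  assumes "continuous_on UNIV h"
  shows "\<exists>C\<ge>0. \<forall>s. \<bar>s\<bar> \<le> R \<longrightarrow> \<bar>h s\<bar> \<le> C"
proof -
  have "compact (h ` {-R..R})"
    by (intro compact_continuous_image continuous_on_subset[OF assms]) auto
  then obtain L where L: "L > 0" "\<And>x. x \<in> {-R..R} \<Longrightarrow> \<bar>h x\<bar> \<le> L"
    using compact_imp_bounded[THEN bounded_pos[THEN iffD1]] by (metis imageI real_norm_def)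
  then show ?thesis by (intro exI[of _ L]) (auto simp: abs_le_iff minus_le_iff)
qed

section \<open>Integrals of continuous functions of bounded measurable functions\<close>

context finite_measure
begin

lemma integrable_continuous_comp:
  fixes h v :: "_ \<Rightarrow> real"
  assumes h: "continuous_on UNIV h" and [measurable]: "v \<in> borel_measurable M"
    and "AE x in M. \<bar>v x\<bar> \<le> R"
  shows "integrable M (\<lambda>x. h (v x))"
proof -
  obtain C where C: "\<And>s. \<bar>s\<bar> \<le> R \<Longrightarrow> \<bar>h s\<bar> \<le> C"
    using continuous_bounded_on_interval[OF h] by blast
  have [measurable]: "h \<in> borel_measurable borel"
    using h by (rule borel_measurable_continuous_onI)
  show ?thesis
  proof (rule integrable_const_bound)
    show "AE x in M. norm (h (v x)) \<le> C" using assms(3) by eventually_elim (simp add: C)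
  qed measurable
qed

lemma tendsto_integral_continuous_comp:
  fixes h w :: "_ \<Rightarrow> real" and v :: "nat \<Rightarrow> _ \<Rightarrow> real"
  assumes h: "continuous_on UNIV h"
    and [measurable]: "\<And>k. v k \<in> borel_measurable M" "w \<in> borel_measurable M"
    and bound: "\<And>k. AE x in M. \<bar>v k x\<bar> \<le> R"
    and lim: "AE x in M. (\<lambda>k. v k x) \<longlonglongrightarrow> w x"
  shows "(\<lambda>k. \<integral>x. h (v k x) \<partial>M) \<longlonglongrightarrow> (\<integral>x. h (w x) \<partial>M)"
proof -
  obtain C where C: "\<And>s. \<bar>s\<bar> \<le> R \<Longrightarrow> \<bar>h s\<bar> \<le> C"
    using continuous_bounded_on_interval[OF h] by blast
  have [measurable]: "h \<in> borel_measurable borel"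
    using h by (rule borel_measurable_continuous_onI)
  show ?thesis
  proof (rule integral_dominated_convergence[where w = "\<lambda>_. C"])
    show "AE x in M. (\<lambda>k. h (v k x)) \<longlonglongrightarrow> h (w x)"
      using lim by eventually_elim (rule continuous_on_tendsto_compose[OF h], auto)
    show "AE x in M. norm (h (v k x)) \<le> C" for k
      using bound[of k] by eventually_elim (simp add: C)
  qed (simp_all add: integrable_const)
qed

end

text \<open>One null set serves the whole sequence: for each \<open>k\<close> the linear
  approximation at \<open>t\<close> fails on a null set depending on \<open>s k\<close>, and the
  union over \<open>k\<close> is still null.\<close>

lemma (in C1_curve) AE_tendsto:
  assumes "\<And>k. s k \<ge> 0" "t \<ge> 0" and lim: "s \<longlonglongrightarrow> t"
  shows "AE x in M. (\<lambda>k. u (s k) x) \<longlonglongrightarrow> u t x"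
proof -
  obtain c where c: "AE x in M. \<bar>u' t x\<bar> \<le> c" using bounded_deriv_at[OF \<open>t \<ge> 0\<close>] by blast
  obtain \<delta> where "\<delta> > 0" and \<delta>: "\<And>s. \<lbrakk>s \<ge> 0; \<bar>s - t\<bar> < \<delta>\<rbrakk> \<Longrightarrow>
      AE x in M. \<bar>u s x - u t x - (s - t) * u' t x\<bar> \<le> 1 * \<bar>s - t\<bar>"
    using deriv_at[OF \<open>t \<ge> 0\<close>, of 1] by force
  have "AE x in M. \<forall>k. \<bar>s k - t\<bar> < \<delta> \<longrightarrow> \<bar>u (s k) x - u t x - (s k - t) * u' t x\<bar> \<le> 1 * \<bar>s k - t\<bar>"
    unfolding AE_all_countable
  proof
    fix k
    show "AE x in M. \<bar>s k - t\<bar> < \<delta> \<longrightarrow> \<bar>u (s k) x - u t x - (s k - t) * u' t x\<bar> \<le> 1 * \<bar>s k - t\<bar>"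
      using \<delta>[of "s k"] assms(1)[of k] by (cases "\<bar>s k - t\<bar> < \<delta>") auto
  qed
  with c show ?thesis
  proof eventually_elim
    case (elim x)
    have near: "\<forall>\<^sub>F k in sequentially. \<bar>s k - t\<bar> < \<delta>"
      using lim \<open>\<delta> > 0\<close> tendstoD by (fastforce simp: dist_real_def)
    have to0: "(\<lambda>k. (1 + c) * \<bar>s k - t\<bar>) \<longlonglongrightarrow> 0"
      using tendsto_mult_right_zero[OF tendsto_rabs_zero[OF LIM_zero[OF lim]], of "1 + c"] .
    have "(\<lambda>k. u (s k) x - u t x) \<longlonglongrightarrow> 0"
    proof (rule Lim_null_comparison[OF _ to0])
      show "\<forall>\<^sub>F k in sequentially. norm (u (s k) x - u t x) \<le> (1 + c) * \<bar>s k - t\<bar>"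
        using near
      proof eventually_elim
        case (elim k)
        have "\<bar>(s k - t) * u' t x\<bar> \<le> c * \<bar>s k - t\<bar>"
          unfolding abs_mult mult.commute[of c]
          using \<open>\<bar>u' t x\<bar> \<le> c\<close> by (intro mult_left_mono) auto
        moreover have "\<bar>u (s k) x - u t x - (s k - t) * u' t x\<bar> \<le> \<bar>s k - t\<bar>"
          using \<open>\<forall>k. _ k \<longrightarrow> _\<close> elim by simp
        ultimately show ?case by (simp add: algebra_simps)
      qed
    qed
    then show ?case by (simp add: LIM_zero_iff)
  qed
qed

section \<open>The common scalar equation and comparison of its solutions\<close>

locale nonlocal_flow = finite_measure M + C1_curve M u u'
  for M :: "'a measure" and u u' :: "real \<Rightarrow> 'a \<Rightarrow> real" +
  fixes p g :: "real \<Rightarrow> real"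
  assumes p_C1: "p C1_differentiable_on UNIV" and p_mono: "strict_mono p"
    and g_C1: "g C1_differentiable_on UNIV"
    and mass_nonzero: "t \<ge> 0 \<Longrightarrow> (\<integral>x. g (u t x) \<partial>M) \<noteq> 0"
    and ode: "t \<ge> 0 \<Longrightarrow> AE x in M. u' t x = g (u t x) * p (u t x) -
        g (u t x) * ((\<integral>y. g (u t y) * p (u t y) \<partial>M) / (\<integral>y. g (u t y) \<partial>M))"
begin

text \<open>The multiplier for which \<open>g (u t x) * (p (u t x) - lam t)\<close> has integral
  zero.\<close>

definition lam :: "real \<Rightarrow> real" where
  "lam t = (\<integral>x. g (u t x) * p (u t x) \<partial>M) / (\<integral>x. g (u t x) \<partial>M)"

lemma ode_lam: "t \<ge> 0 \<Longrightarrow> AE x in M. u' t x = g (u t x) * (p (u t x) - lam t)"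
  using ode[of t] by (simp add: lam_def algebra_simps)

lemmas p_cont = C1_continuous_on[OF p_C1] and g_cont = C1_continuous_on[OF g_C1]

lemma gp_cont: "continuous_on S (\<lambda>s. g s * p s)"
  by (intro continuous_intros p_cont g_cont)

lemma integrable_comp:
  "continuous_on UNIV h \<Longrightarrow> t \<ge> 0 \<Longrightarrow> integrable M (\<lambda>x. h (u t x) :: real)"
  using bounded_at[of t] meas[of t] integrable_continuous_comp[of h "u t"] by blast

lemma continuous_integral_comp:
  fixes h :: "real \<Rightarrow> real"
  assumes "continuous_on UNIV h"
  shows "continuous_on {0..} (\<lambda>t. \<integral>x. h (u t x) \<partial>M)"
  unfolding continuous_on_sequentially
proof (intro allI ballI impI, elim conjE, unfold o_def)
  fix s :: "nat \<Rightarrow> real" and t assume t: "t \<in> {0..}" and s: "\<forall>n. s n \<in> {0..}" and lim: "s \<longlonglongrightarrow> t"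
  \<comment> \<open>A convergent sequence of times stays in some \<open>[0, T]\<close>, which
    supplies one bound \<open>R\<close> for dominated convergence.\<close>
  obtain T where T: "\<And>n. \<bar>s n\<bar> \<le> T"
    using convergent_imp_Bseq[OF convergentI[OF lim]] by (auto simp: Bseq_def)
  have "0 \<le> T" using T[of 0] by simp
  then obtain R where R: "\<And>t. 0 \<le> t \<Longrightarrow> t \<le> T \<Longrightarrow> AE x in M. \<bar>u t x\<bar> \<le> R"
    using AE_bounded_on by blast
  show "(\<lambda>n. \<integral>x. h (u (s n) x) \<partial>M) \<longlonglongrightarrow> (\<integral>x. h (u t x) \<partial>M)"
  proof (rule tendsto_integral_continuous_comp[OF assms])
    show "AE x in M. \<bar>u (s k) x\<bar> \<le> R" for k
      using s T[of k] by (intro R) auto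
  qed (use s t lim AE_tendsto in auto)
qed

lemma lam_cont: "continuous_on {0..} lam"
  unfolding lam_def using mass_nonzero
  by (intro continuous_on_divide continuous_integral_comp gp_cont g_cont) auto

text \<open>With no sign of \<open>g (u t x)\<close> at hand, \<open>lam\<close> is controlled by
  its continuity on \<open>[0, T]\<close>; splitting the right-hand side into \<open>g * p\<close>
  and \<open>lam * g\<close> gives the constant \<open>L' + C * L\<close>.\<close>

lemma rhs_Lipschitz:
  "\<exists>L\<ge>0. \<forall>t a b. 0 \<le> t \<longrightarrow> t \<le> T \<longrightarrow> \<bar>a\<bar> \<le> R \<longrightarrow> \<bar>b\<bar> \<le> R \<longrightarrow>
      \<bar>g a * (p a - lam t) - g b * (p b - lam t)\<bar> \<le> L * \<bar>a - b\<bar>"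
proof -
  have "compact (lam ` {0..T})"
    by (intro compact_continuous_image continuous_on_subset[OF lam_cont]) auto
  then obtain C where C: "C > 0" "\<And>t. t \<in> {0..T} \<Longrightarrow> \<bar>lam t\<bar> \<le> C"
    using compact_imp_bounded[THEN bounded_pos[THEN iffD1]] by (metis imageI real_norm_def)
  obtain L where L: "L \<ge> 0" "\<And>a b. \<bar>a\<bar> \<le> R \<Longrightarrow> \<bar>b\<bar> \<le> R \<Longrightarrow> \<bar>g a - g b\<bar> \<le> L * \<bar>a - b\<bar>"
    using C1_locally_Lipschitz[OF g_C1, of R] by blast
  have "(\<lambda>s. g s * p s) C1_differentiable_on UNIV"
    by (intro C1_differentiable_on_mult g_C1 p_C1)
  then obtain L' where L': "L' \<ge> 0"
    "\<And>a b. \<bar>a\<bar> \<le> R \<Longrightarrow> \<bar>b\<bar> \<le> R \<Longrightarrow> \<bar>g a * p a - g b * p b\<bar> \<le> L' * \<bar>a - b\<bar>"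
    using C1_locally_Lipschitz[of "\<lambda>s. g s * p s" R] by blast
  have "\<bar>g a * (p a - lam t) - g b * (p b - lam t)\<bar> \<le> (L' + C * L) * \<bar>a - b\<bar>"
    if "0 \<le> t" "t \<le> T" "\<bar>a\<bar> \<le> R" "\<bar>b\<bar> \<le> R" for t a b
  proof -
    have "\<bar>lam t * (g a - g b)\<bar> \<le> C * (L * \<bar>a - b\<bar>)"
      unfolding abs_mult using that C(2)[of t] L(2)[of a b] C(1) by (intro mult_mono) auto
    moreover have "\<bar>g a * p a - g b * p b\<bar> \<le> L' * \<bar>a - b\<bar>" using that L'(2) by blast
    moreover have "g a * (p a - lam t) - g b * (p b - lam t) = (g a * p a - g b * p b) - lam t * (g a - g b)"
      "(L' + C * L) * \<bar>a - b\<bar> = L' * \<bar>a - b\<bar> + C * (L * \<bar>a - b\<bar>)"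
      by (simp_all add: algebra_simps)
    ultimately show ?thesis by linarith
  qed
  then show ?thesis using L(1) L'(1) C(1) by (intro exI[of _ "L' + C * L"]) auto
qed

text \<open>\<open>uniform_deriv\<close> bounds the residual uniformly in \<open>k\<close>, and
  \<open>ode_lam\<close> replaces \<open>u'\<close> by the right-hand side.\<close>

lemma AE_euler_exact:
  assumes "T \<ge> 0"
  shows "AE x in M. euler_exact (\<lambda>t s. g s * (p s - lam t)) T (\<lambda>t. u t x)"
proof -
  let ?P = "\<lambda>\<epsilon> N k x. \<bar>u (real (Suc k) * (T / real N)) x - u (real k * (T / real N)) x - T / real N *
      (g (u (real k * (T / real N)) x) * (p (u (real k * (T / real N)) x) - lam (real k * (T / real N))))\<bar>
      \<le> \<epsilon> * (T / real N)"
  have approx: "\<exists>N0. \<forall>N k. N0 \<le> N \<and> k < N \<longrightarrow> (AE x in M. ?P \<epsilon> N k x)" if \<epsilon>: "\<epsilon> > 0" for \<epsilon>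
  proof -
    obtain \<delta> where "\<delta> > 0" and \<delta>: "\<And>s t. \<lbrakk>0 \<le> s; s \<le> t; t \<le> T; t - s < \<delta>\<rbrakk> \<Longrightarrow>
          AE x in M. \<bar>u t x - u s x - (t - s) * u' s x\<bar> \<le> \<epsilon> * (t - s)"
      using uniform_deriv[OF \<epsilon>, of T] by blast
    obtain N0 :: nat where N0: "real N0 > T / \<delta>" using reals_Archimedean2 by blast
    have "AE x in M. ?P \<epsilon> N k x" if "N0 \<le> N" "k < N" for N k :: nat
    proof -
      define h where "h = T / real N"
      have "real N > T / \<delta>" using N0 that by linarith
      then have h: "h \<ge> 0" "h < \<delta>" "N * h = T"
        using \<open>T \<ge> 0\<close> \<open>\<delta> > 0\<close> that by (auto simp: h_def field_simps)
      define s t where "s = real k * h" and "t = real (Suc k) * h"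
      have "real (Suc k) * h \<le> N * h" using that h(1) by (intro mult_right_mono) auto
      then have st: "0 \<le> s" "s \<le> t" "t \<le> T" "t - s = h"
        using h by (auto simp: s_def t_def algebra_simps)
      have "AE x in M. \<bar>u t x - u s x - (t - s) * u' s x\<bar> \<le> \<epsilon> * (t - s)"
        by (rule \<delta>) (use st h in auto)
      with ode_lam[OF st(1)] show ?thesis
        unfolding h_def[symmetric] s_def[symmetric] t_def[symmetric] st(4)
        by eventually_elim simp
    qed
    then show ?thesis by blast
  qed
  \<comment> \<open>Tolerances are restricted to \<open>1 / (j + 1)\<close>, so that only countably
    many triples \<open>(j, N, k)\<close> occur and a single null set serves them all.\<close>
  have "\<forall>j. \<exists>N0. \<forall>N k. N0 \<le> N \<and> k < N \<longrightarrow> (AE x in M. ?P (1 / real (Suc j)) N k x)"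
    by (intro allI approx) simp
  from choice[OF this] obtain N0 where
    N0: "\<And>j N k. N0 j \<le> N \<Longrightarrow> k < N \<Longrightarrow> AE x in M. ?P (1 / real (Suc j)) N k x" by blast
  have "AE x in M. \<forall>j N k. N0 j \<le> N \<and> k < N \<longrightarrow> ?P (1 / real (Suc j)) N k x"
    unfolding AE_all_countable using N0 by (intro allI AE_impI) blast
  then show ?thesis
  proof eventually_elim
    case (elim x)
    show ?case unfolding euler_exact_def
    proof (intro allI impI)
      fix \<epsilon> :: real assume "\<epsilon> > 0"
      then obtain j where "1 / real (Suc j) < \<epsilon>" using nat_approx_posE by blast
      show "\<forall>\<^sub>F N in sequentially. \<forall>k<N. ?P \<epsilon> N k x"
        using eventually_ge_at_top[of "N0 j"]
      proof eventually_elim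
        case (elim N)
        have "1 / real (Suc j) * (T / real N) \<le> \<epsilon> * (T / real N)"
          using \<open>1 / real (Suc j) < \<epsilon>\<close> \<open>T \<ge> 0\<close> by (intro mult_right_mono) auto
        then show ?case
          using \<open>\<forall>j N k. _ j N k\<close> elim by (meson order_trans)
      qed
    qed
  qed
qed

lemma AE_bounded_on_grid:
  assumes "T \<ge> 0"
  shows "\<exists>R. AE x in M. \<forall>N k. k \<le> N \<longrightarrow> \<bar>u (real k * (T / real N)) x\<bar> \<le> R"
proof -
  obtain R where R: "\<And>t. 0 \<le> t \<Longrightarrow> t \<le> T \<Longrightarrow> AE x in M. \<bar>u t x\<bar> \<le> R"
    using AE_bounded_on[OF assms] by blast
  have "0 \<le> real k * (T / real N) \<and> real k * (T / real N) \<le> T" if "k \<le> N" for k N :: nat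
    using that assms mult_right_mono[of "real k" "real N" T] by (cases "N = 0") (auto simp: field_simps)
  then have "AE x in M. \<forall>N k. k \<le> N \<longrightarrow> \<bar>u (real k * (T / real N)) x\<bar> \<le> R"
    unfolding AE_all_countable using R by (intro allI AE_impI) blast
  then show ?thesis ..
qed

text \<open>All points of the good set \<open>Q\<close> obey the same scalar equation, so
  \<open>euler_exact_comparison\<close> applies to every pair of them. This is the form required by
  \<open>Helly_selection_factored\<close> with \<open>h = u 0\<close>.\<close>

lemma AE_order_Lipschitz:
  assumes "T \<ge> 0"
  shows "\<exists>K\<ge>0. \<exists>Q. (AE x in M. Q x) \<and>
      (\<forall>x y. Q x \<longrightarrow> Q y \<longrightarrow> max 0 (u T x - u T y) \<le> K * max 0 (u 0 x - u 0 y))"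
proof -
  obtain R where R: "AE x in M. \<forall>N k. k \<le> N \<longrightarrow> \<bar>u (real k * (T / real N)) x\<bar> \<le> R"
    using AE_bounded_on_grid[OF assms] by blast
  obtain L where L: "L \<ge> 0" "\<And>t a b. \<lbrakk>0 \<le> t; t \<le> T; \<bar>a\<bar> \<le> R; \<bar>b\<bar> \<le> R\<rbrakk> \<Longrightarrow>
      \<bar>g a * (p a - lam t) - g b * (p b - lam t)\<bar> \<le> L * \<bar>a - b\<bar>"
    using rhs_Lipschitz[of T R] by blast
  let ?Q = "\<lambda>x. euler_exact (\<lambda>t s. g s * (p s - lam t)) T (\<lambda>t. u t x) \<and>
      (\<forall>N k. k \<le> N \<longrightarrow> \<bar>u (real k * (T / real N)) x\<bar> \<le> R)"
  have "AE x in M. ?Q x" using AE_euler_exact[OF assms] R by eventually_elim simp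
  moreover have "max 0 (u T x - u T y) \<le> exp (L * T) * max 0 (u 0 x - u 0 y)" if "?Q x" "?Q y" for x y
    by (rule euler_exact_comparison[OF assms L(1), of R "\<lambda>t s. g s * (p s - lam t)"])
      (use L(2) that in auto)
  ultimately show ?thesis by (intro exI[of _ "exp (L * T)"] conjI exI[of _ ?Q]) auto
qed

text \<open>As \<open>g c = 0\<close>, the constant \<open>c\<close> satisfies the Euler scheme
  exactly; comparing it with a path in both orders shows that the path cannot cross it.\<close>

lemma AE_zero_barrier:
  assumes "T \<ge> 0" "g c = 0"
  shows "AE x in M. (c \<le> u 0 x \<longrightarrow> c \<le> u T x) \<and> (u 0 x \<le> c \<longrightarrow> u T x \<le> c)"
proof -
  obtain R0 where R0: "AE x in M. \<forall>N k. k \<le> N \<longrightarrow> \<bar>u (real k * (T / real N)) x\<bar> \<le> R0"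
    using AE_bounded_on_grid[OF assms(1)] by blast
  define R where "R = max R0 \<bar>c\<bar>"
  obtain L where L: "L \<ge> 0" "\<And>t a b. \<lbrakk>0 \<le> t; t \<le> T; \<bar>a\<bar> \<le> R; \<bar>b\<bar> \<le> R\<rbrakk> \<Longrightarrow>
      \<bar>g a * (p a - lam t) - g b * (p b - lam t)\<bar> \<le> L * \<bar>a - b\<bar>"
    using rhs_Lipschitz[of T R] by blast
  from AE_euler_exact[OF assms(1)] R0 show ?thesis
  proof eventually_elim
    case (elim x)
    have c: "euler_exact (\<lambda>t s. g s * (p s - lam t)) T (\<lambda>_. c)"
      by (rule euler_exact_const) (use assms in auto)
    have bnd: "\<bar>u (real k * (T / real N)) x\<bar> \<le> R" if "k \<le> N" for k N
      using elim(2) that by (auto simp: R_def intro: le_max_iff_disj[THEN iffD2])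
    have "\<bar>c\<bar> \<le> R" by (simp add: R_def)
    have "max 0 (u T x - c) \<le> exp (L * T) * max 0 (u 0 x - c)"
      by (rule euler_exact_comparison[OF assms(1) L(1) L(2) elim(1) bnd c]) (use \<open>\<bar>c\<bar> \<le> R\<close> in auto)
    moreover have "max 0 (c - u T x) \<le> exp (L * T) * max 0 (c - u 0 x)"
      by (rule euler_exact_comparison[OF assms(1) L(1) L(2) c _ elim(1) bnd]) (use \<open>\<bar>c\<bar> \<le> R\<close> in auto)
    ultimately show ?case by auto
  qed
qed

end

section \<open>Confinement of the solution to a compact interval\<close>

context nonlocal_flow
begin

text \<open>\<open>\<sigma> * g (u t x)\<close> is a nonnegative weight, with positive total mass by
  \<open>mass_nonzero\<close>, and \<open>lam t\<close> is the mean of \<open>p (u t x)\<close> for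
  it, unchanged by the factor \<open>\<sigma>\<close>.\<close>

lemma lam_bounds:
  assumes "t \<ge> 0" and range: "AE x in M. a \<le> u t x \<and> u t x \<le> b"
    and \<sigma>: "\<And>s. a \<le> s \<Longrightarrow> s \<le> b \<Longrightarrow> \<sigma> * g s \<ge> 0" "\<sigma> \<noteq> 0"
  shows "p a \<le> lam t \<and> lam t \<le> p b"
proof -
  have int: "integrable M (\<lambda>x. g (u t x))" "integrable M (\<lambda>x. g (u t x) * p (u t x))"
    using integrable_comp[OF g_cont \<open>t \<ge> 0\<close>] integrable_comp[OF gp_cont \<open>t \<ge> 0\<close>] by auto
  define G H where "G = (\<integral>x. g (u t x) \<partial>M)" and "H = (\<integral>x. g (u t x) * p (u t x) \<partial>M)"
  have "0 \<le> (\<integral>x. \<sigma> * g (u t x) \<partial>M)"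
    by (rule integral_nonneg_AE) (use range in \<open>eventually_elim, simp add: \<sigma>\<close>)
  then have pos: "\<sigma> * G > 0"
    using mass_nonzero[OF \<open>t \<ge> 0\<close>] \<sigma>(2) by (simp add: G_def less_le)
  have "(\<integral>x. \<sigma> * (g (u t x) * p (u t x)) \<partial>M) \<le> (\<integral>x. p b * (\<sigma> * g (u t x)) \<partial>M)"
  proof (rule integral_mono_AE)
    show "AE x in M. \<sigma> * (g (u t x) * p (u t x)) \<le> p b * (\<sigma> * g (u t x))"
      using range
    proof eventually_elim
      case (elim x)
      then have "(\<sigma> * g (u t x)) * p (u t x) \<le> (\<sigma> * g (u t x)) * p b"
        using \<sigma>(1) p_mono by (intro mult_left_mono) (auto simp: strict_mono_less_eq)
      then show ?case by (simp add: mult_ac)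
    qed
  qed (use int in auto)
  then have upper: "\<sigma> * H \<le> p b * (\<sigma> * G)" by (simp add: H_def G_def)
  have "(\<integral>x. p a * (\<sigma> * g (u t x)) \<partial>M) \<le> (\<integral>x. \<sigma> * (g (u t x) * p (u t x)) \<partial>M)"
  proof (rule integral_mono_AE)
    show "AE x in M. p a * (\<sigma> * g (u t x)) \<le> \<sigma> * (g (u t x) * p (u t x))"
      using range
    proof eventually_elim
      case (elim x)
      then have "(\<sigma> * g (u t x)) * p a \<le> (\<sigma> * g (u t x)) * p (u t x)"
        using \<sigma>(1) p_mono by (intro mult_left_mono) (auto simp: strict_mono_less_eq)
      then show ?case by (simp add: mult_ac)
    qed
  qed (use int in auto)
  then have lower: "p a * (\<sigma> * G) \<le> \<sigma> * H" by (simp add: H_def G_def)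
  have "lam t = (\<sigma> * H) / (\<sigma> * G)" using \<sigma>(2) by (simp add: lam_def G_def H_def)
  then show ?thesis
    unfolding \<open>lam t = _\<close> pos_le_divide_eq[OF pos] pos_divide_le_eq[OF pos] using upper lower by blast
qed

lemma p_Lipschitz_g_bounded:
  obtains L C where "L \<ge> 0" "C \<ge> 0" "\<And>s. \<bar>s\<bar> \<le> R \<Longrightarrow> \<bar>g s\<bar> \<le> C"
    "\<And>a b. \<bar>a\<bar> \<le> R \<Longrightarrow> \<bar>b\<bar> \<le> R \<Longrightarrow> \<bar>p a - p b\<bar> \<le> L * \<bar>a - b\<bar>"
  using C1_locally_Lipschitz[OF p_C1, of R] continuous_bounded_on_interval[OF g_cont, of R] by blast

text \<open>While \<open>u \<le> c\<close>, the mean \<open>lam\<close> is at most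
  \<open>p c\<close>. Where \<open>u \<ge> 1\<close> the factor \<open>- g u\<close> is nonnegative,
  so the speed is at most \<open>(- g u) * (p c - p u) \<le> C * L * (c - u)\<close>, the inward
  condition of \<open>AE_upper_bound\<close>.\<close>

lemma AE_le_of_ge_1:
  assumes "g 1 = 0" and g_neg: "\<And>s. 1 \<le> s \<Longrightarrow> g s \<le> 0"
    and init: "AE x in M. 1 \<le> u 0 x \<and> u 0 x \<le> B" "1 \<le> B" and "T \<ge> 0"
  shows "AE x in M. u T x \<le> B"
proof -
  \<comment> \<open>The radius is \<open>B + 1\<close> because \<open>AE_upper_bound\<close> tests
    levels \<open>c\<close> up to \<open>B + 1\<close>.\<close>
  obtain L C where L: "L \<ge> 0" "C \<ge> 0" "\<And>s. \<bar>s\<bar> \<le> B + 1 \<Longrightarrow> \<bar>g s\<bar> \<le> C"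
    "\<And>a b. \<bar>a\<bar> \<le> B + 1 \<Longrightarrow> \<bar>b\<bar> \<le> B + 1 \<Longrightarrow> \<bar>p a - p b\<bar> \<le> L * \<bar>a - b\<bar>"
    using p_Lipschitz_g_bounded by blast
  have ge: "AE x in M. 1 \<le> u t x" if "t \<ge> 0" for t
    using AE_zero_barrier[OF that \<open>g 1 = 0\<close>] init(1) by eventually_elim simp
  show ?thesis
  proof (rule AE_upper_bound[OF \<open>T \<ge> 0\<close>])
    show "C * L \<ge> 0" using L by simp
    show "AE x in M. u 0 x \<le> B" using init(1) by eventually_elim simp
    fix t c assume t: "0 \<le> t" and c: "B \<le> c" "c \<le> B + 1" "AE x in M. u t x \<le> c"
    have "AE x in M. 1 \<le> u t x \<and> u t x \<le> c" using ge[OF t] c(3) by eventually_elim simp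
    then have lam: "lam t \<le> p c" using lam_bounds[OF t, of 1 c "-1"] g_neg by auto
    from ode_lam[OF t] ge[OF t] c(3) show "AE x in M. u' t x \<le> C * L * (c - u t x)"
    proof eventually_elim
      case (elim x)
      define s where "s = u t x"
      have s: "1 \<le> s" "s \<le> c" "\<bar>s\<bar> \<le> B + 1" "\<bar>c\<bar> \<le> B + 1" using elim c init(2) by (auto simp: s_def)
      have "u' t x = (- g s) * (lam t - p s)" using elim by (simp add: s_def algebra_simps)
      also have "\<dots> \<le> (- g s) * (p c - p s)" using g_neg[OF s(1)] lam by (intro mult_left_mono) auto
      also have "\<dots> \<le> C * (L * \<bar>c - s\<bar>)"
      proof (rule mult_mono)
        show "- g s \<le> C" using L(3)[OF s(3)] by linarith
        show "p c - p s \<le> L * \<bar>c - s\<bar>" using L(4)[OF s(4,3)] by linarith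
        show "0 \<le> p c - p s" using s p_mono by (simp add: strict_mono_less_eq)
      qed (rule L)
      finally show ?case using s by (simp add: s_def)
    qed
  qed
qed

text \<open>Mirror image on the negative half line: \<open>- u\<close> is again a
  \<open>C1_curve\<close>, and \<open>- c \<le> u\<close> forces
  \<open>p (- c) \<le> lam\<close>.\<close>

lemma AE_ge_of_le_0:
  assumes "g 0 = 0" and g_neg: "\<And>s. s \<le> 0 \<Longrightarrow> g s \<le> 0"
    and init: "AE x in M. - B \<le> u 0 x \<and> u 0 x \<le> 0" "0 \<le> B" and "T \<ge> 0"
  shows "AE x in M. - B \<le> u T x"
proof -
  interpret neg: C1_curve M "\<lambda>t x. - u t x" "\<lambda>t x. - u' t x" by (rule C1_curve_uminus)
  obtain L C where L: "L \<ge> 0" "C \<ge> 0" "\<And>s. \<bar>s\<bar> \<le> B + 1 \<Longrightarrow> \<bar>g s\<bar> \<le> C"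
    "\<And>a b. \<bar>a\<bar> \<le> B + 1 \<Longrightarrow> \<bar>b\<bar> \<le> B + 1 \<Longrightarrow> \<bar>p a - p b\<bar> \<le> L * \<bar>a - b\<bar>"
    using p_Lipschitz_g_bounded by blast
  have le: "AE x in M. u t x \<le> 0" if "t \<ge> 0" for t
    using AE_zero_barrier[OF that \<open>g 0 = 0\<close>] init(1) by eventually_elim simp
  have "AE x in M. - u T x \<le> B"
  proof (rule neg.AE_upper_bound[OF \<open>T \<ge> 0\<close>])
    show "C * L \<ge> 0" using L by simp
    show "AE x in M. - u 0 x \<le> B" using init(1) by eventually_elim simp
    fix t c assume t: "0 \<le> t" and c: "B \<le> c" "c \<le> B + 1" "AE x in M. - u t x \<le> c"
    have "AE x in M. - c \<le> u t x \<and> u t x \<le> 0" using le[OF t] c(3) by eventually_elim simp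
    then have lam: "p (- c) \<le> lam t" using lam_bounds[OF t, of "-c" 0 "-1"] g_neg by auto
    from ode_lam[OF t] le[OF t] c(3) show "AE x in M. - u' t x \<le> C * L * (c - - u t x)"
    proof eventually_elim
      case (elim x)
      define s where "s = u t x"
      have s: "s \<le> 0" "- c \<le> s" "\<bar>s\<bar> \<le> B + 1" "\<bar>- c\<bar> \<le> B + 1"
        using elim c init(2) by (auto simp: s_def)
      have "- u' t x = (- g s) * (p s - lam t)" using elim by (simp add: s_def algebra_simps)
      also have "\<dots> \<le> (- g s) * (p s - p (- c))" using g_neg[OF s(1)] lam by (intro mult_left_mono) auto
      also have "\<dots> \<le> C * (L * \<bar>s - - c\<bar>)"
      proof (rule mult_mono)
        show "- g s \<le> C" using L(3)[OF s(3)] by linarith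
        show "p s - p (- c) \<le> L * \<bar>s - - c\<bar>" using L(4)[OF s(3,4)] by linarith
        show "0 \<le> p s - p (- c)" using s p_mono by (simp add: strict_mono_less_eq)
      qed (rule L)
      finally show ?case using s by (simp add: s_def add.commute)
    qed
  qed
  then show ?thesis by eventually_elim simp
qed

end

section \<open>Differentiation of integrals along the flow\<close>

lemma (in C1_curve) AE_tendsto_deriv:
  assumes "\<And>k. s k \<ge> 0" "\<And>k. s k \<noteq> t" "t \<ge> 0" and lim: "s \<longlonglongrightarrow> t"
  shows "AE x in M. (\<lambda>k. (u (s k) x - u t x) / (s k - t)) \<longlonglongrightarrow> u' t x"
proof -
  have "\<forall>j. \<exists>\<delta>>0. \<forall>s\<ge>0. \<bar>s - t\<bar> < \<delta> \<longrightarrow>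
      (AE x in M. \<bar>u s x - u t x - (s - t) * u' t x\<bar> \<le> 1 / real (Suc j) * \<bar>s - t\<bar>)"
    by (intro allI deriv_at[OF \<open>t \<ge> 0\<close>]) simp
  from choice[OF this] obtain \<delta> where \<delta>: "\<And>j. \<delta> j > 0" "\<And>j s. \<lbrakk>s \<ge> 0; \<bar>s - t\<bar> < \<delta> j\<rbrakk> \<Longrightarrow>
      AE x in M. \<bar>u s x - u t x - (s - t) * u' t x\<bar> \<le> 1 / real (Suc j) * \<bar>s - t\<bar>" by blast
  have "AE x in M. \<forall>j k. \<bar>s k - t\<bar> < \<delta> j \<longrightarrow>
      \<bar>u (s k) x - u t x - (s k - t) * u' t x\<bar> \<le> 1 / real (Suc j) * \<bar>s k - t\<bar>"
    unfolding AE_all_countable using \<delta>(2) assms(1) by (intro allI AE_impI) blast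
  then show ?thesis
  proof eventually_elim
    case (elim x)
    show ?case
    proof (rule LIMSEQ_I)
      fix \<epsilon> :: real assume "\<epsilon> > 0"
      then obtain j where j: "1 / real (Suc j) < \<epsilon>" using nat_approx_posE by blast
      obtain N where N: "\<And>k. k \<ge> N \<Longrightarrow> \<bar>s k - t\<bar> < \<delta> j"
        using LIMSEQ_D[OF lim \<delta>(1)[of j]] by auto
      have "norm ((u (s k) x - u t x) / (s k - t) - u' t x) < \<epsilon>" if "k \<ge> N" for k
      proof -
        have "(u (s k) x - u t x) / (s k - t) - u' t x = (u (s k) x - u t x - (s k - t) * u' t x) / (s k - t)"
          using assms(2)[of k] by (simp add: field_simps)
        also have "\<bar>\<dots>\<bar> \<le> 1 / real (Suc j)"
          unfolding abs_divide using elim[rule_format, OF N[OF that]] assms(2)[of k]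
          by (subst pos_divide_le_eq) auto
        finally show ?thesis using j by simp
      qed
      then show "\<exists>N. \<forall>k\<ge>N. norm ((u (s k) x - u t x) / (s k - t) - u' t x) < \<epsilon>" by blast
    qed
  qed
qed

text \<open>Caratheodory's factorisation of \<open>P\<close> avoids dividing by
  \<open>Y k - y\<close>, which may vanish.\<close>

lemma tendsto_difference_quotient_chain:
  fixes P :: "real \<Rightarrow> real"
  assumes "(P has_real_derivative d) (at y)" "Y \<longlonglongrightarrow> y" "(\<lambda>k. (Y k - y) / h k) \<longlonglongrightarrow> v"
  shows "(\<lambda>k. (P (Y k) - P y) / h k) \<longlonglongrightarrow> d * v"
proof -
  obtain q where q: "\<And>z. P z - P y = q z * (z - y)" "isCont q y" "q y = d"
    using assms(1) unfolding CARAT_DERIV by blast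
  have "(\<lambda>k. q (Y k) * ((Y k - y) / h k)) \<longlonglongrightarrow> d * v"
    using isCont_tendsto_compose[OF q(2) assms(2)] assms(3) q(3) by (intro tendsto_mult) auto
  then show ?thesis by (simp add: q(1))
qed

lemma has_real_derivative_primitive:
  assumes "continuous_on UNIV p"
  shows "(primitive p has_real_derivative p s) (at s)"
proof -
  \<comment> \<open>The interval contains 0 and \<open>s\<close> in its interior whatever the sign
    of \<open>s\<close>, so the derivative within it is the two-sided one.\<close>
  have "((\<lambda>s. LBINT y=ereal 0..ereal s. p y) has_vector_derivative p s)
      (at s within {min 0 s - 1..max 0 s + 1})"
    by (rule interval_integral_FTC2) (auto intro: continuous_on_subset[OF assms])
  moreover have "at s within {min 0 s - 1..max 0 s + 1} = at s"
    by (rule at_within_interior) (auto simp: min_def max_def)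
  ultimately show ?thesis
    unfolding has_real_derivative_iff_has_vector_derivative primitive_def zero_ereal_def by simp
qed

lemma primitive_C1:
  assumes "continuous_on UNIV p"
  shows "primitive p C1_differentiable_on UNIV"
  using has_real_derivative_primitive[OF assms] assms
  by (auto simp: C1_differentiable_on_def has_real_derivative_iff_has_vector_derivative)

text \<open>The common core of the three cases: an invariant interval \<open>[a, b]\<close> on which
  \<open>g\<close> has a constant sign; \<open>\<sigma> * \<sigma> = 1\<close> says that
  \<open>\<sigma>\<close> is 1 or -1.\<close>

locale trapped_flow = nonlocal_flow M u u' p g
  for M :: "'a measure" and u u' p g +
  fixes a b \<sigma> :: real
  assumes trapped: "t \<ge> 0 \<Longrightarrow> AE x in M. a \<le> u t x \<and> u t x \<le> b"
    and sign: "\<And>s. a \<le> s \<Longrightarrow> s \<le> b \<Longrightarrow> \<sigma> * g s \<ge> 0"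
    and sigma: "\<sigma> * \<sigma> = 1"
begin

lemma AE_bounded:
  assumes "t \<ge> 0"
  shows "AE x in M. \<bar>u t x\<bar> \<le> max \<bar>a\<bar> \<bar>b\<bar>"
  using trapped[OF assms] by eventually_elim auto

text \<open>Because \<open>lam\<close> lies between \<open>p a\<close> and \<open>p b\<close>, the
  speed is bounded independently of time.\<close>

lemma AE_Lipschitz:
  "\<exists>K>0. \<forall>s t. 0 \<le> s \<longrightarrow> 0 \<le> t \<longrightarrow> (AE x in M. \<bar>u t x - u s x\<bar> \<le> K * \<bar>t - s\<bar>)"
proof -
  obtain C where C: "C \<ge> 0" "\<And>s. \<bar>s\<bar> \<le> max \<bar>a\<bar> \<bar>b\<bar> \<Longrightarrow> \<bar>g s\<bar> \<le> C"
    using continuous_bounded_on_interval[OF g_cont] by blast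
  have speed: "AE x in M. \<bar>u' t x - 0\<bar> \<le> C * \<bar>p b - p a\<bar>" if "t \<ge> 0" for t
    using ode_lam[OF that] trapped[OF that]
  proof eventually_elim
    case (elim x)
    have "p a \<le> lam t \<and> lam t \<le> p b"
      by (rule lam_bounds[OF that trapped[OF that] sign]) (use sigma in auto)
    moreover have "p a \<le> p (u t x)" "p (u t x) \<le> p b"
      using elim p_mono by (auto simp: strict_mono_less_eq)
    ultimately have "\<bar>p (u t x) - lam t\<bar> \<le> \<bar>p b - p a\<bar>" by linarith
    moreover have "\<bar>g (u t x)\<bar> \<le> C" using elim by (intro C(2)) auto
    ultimately show ?case unfolding elim(1) using C(1) by (simp add: abs_mult mult_mono)
  qed
  \<comment> \<open>The summand 1 is the slack of \<open>mean_value\<close>, applied with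
    \<open>w = 0\<close>, and also makes \<open>K\<close> positive.\<close>
  define K where "K = C * \<bar>p b - p a\<bar> + 1"
  have fwd: "AE x in M. \<bar>u t x - u s x\<bar> \<le> K * (t - s)" if "0 \<le> s" "s \<le> t" for s t
    using mean_value[OF that, of 1 "\<lambda>_. 0" "C * \<bar>p b - p a\<bar>"] speed that by (simp add: K_def)
  have "AE x in M. \<bar>u t x - u s x\<bar> \<le> K * \<bar>t - s\<bar>" if "0 \<le> s" "0 \<le> t" for s t
    using fwd[of s t] fwd[of t s] that by (cases "s \<le> t") (auto simp: abs_minus_commute)
  moreover have "K > 0" using C(1) by (simp add: K_def add_nonneg_pos)
  ultimately show ?thesis by blast
qed

section \<open>Dissipation and the Lyapunov function\<close>

definition dissipation :: "real \<Rightarrow> real" where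
  "dissipation t = \<sigma> * (\<integral>x. g (u t x) * (p (u t x) - lam t)\<^sup>2 \<partial>M)"

lemma dissipation_nonneg: "t \<ge> 0 \<Longrightarrow> dissipation t \<ge> 0"
proof -
  assume "t \<ge> 0"
  have "0 \<le> (\<integral>x. \<sigma> * (g (u t x) * (p (u t x) - lam t)\<^sup>2) \<partial>M)"
  proof (rule integral_nonneg_AE)
    show "AE x in M. 0 \<le> \<sigma> * (g (u t x) * (p (u t x) - lam t)\<^sup>2)"
      using trapped[OF \<open>t \<ge> 0\<close>]
    proof eventually_elim
      case (elim x)
      then have "0 \<le> (\<sigma> * g (u t x)) * (p (u t x) - lam t)\<^sup>2"
        using sign by (intro mult_nonneg_nonneg[OF _ zero_le_power2]) blast
      then show ?case by (simp only: mult.assoc)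
    qed
  qed
  then show ?thesis by (simp add: dissipation_def)
qed

text \<open>Both forms come from expanding and using that the integral of \<open>g * p\<close> is
  \<open>lam t * G\<close>. The first involves only integrals of continuous functions of
  \<open>u\<close> and so passes to limits; the second is, up to the sign \<open>\<sigma>\<close>,
  the derivative of the integral of \<open>primitive p (u t x)\<close>.\<close>

lemma dissipation_eq:
  assumes "t \<ge> 0"
  shows "dissipation t = \<sigma> * ((\<integral>x. g (u t x) * (p (u t x))\<^sup>2 \<partial>M) -
    (\<integral>x. g (u t x) * p (u t x) \<partial>M)\<^sup>2 / (\<integral>x. g (u t x) \<partial>M))" (is ?th1)
    and "dissipation t = \<sigma> * (\<integral>x. p (u t x) * u' t x \<partial>M)" (is ?th2)
proof -
  have "continuous_on UNIV (\<lambda>s. g s * (p s)\<^sup>2)" by (intro continuous_intros p_cont g_cont)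
  note int = integrable_comp[OF this assms] integrable_comp[OF gp_cont assms]
    integrable_comp[OF g_cont assms]
  define G where "G = (\<integral>x. g (u t x) \<partial>M)"
  have "G \<noteq> 0" using mass_nonzero[OF assms] by (simp add: G_def)
  have lam: "(\<integral>x. g (u t x) * p (u t x) \<partial>M) = lam t * G"
    using \<open>G \<noteq> 0\<close> by (simp add: lam_def G_def)
  have "(\<integral>x. g (u t x) * (p (u t x) - lam t)\<^sup>2 \<partial>M) =
      (\<integral>x. g (u t x) * (p (u t x))\<^sup>2 - (2 * lam t) * (g (u t x) * p (u t x)) + (lam t)\<^sup>2 * g (u t x) \<partial>M)"
    by (rule Bochner_Integration.integral_cong) (auto simp: power2_eq_square algebra_simps)
  also have "\<dots> = (\<integral>x. g (u t x) * (p (u t x))\<^sup>2 \<partial>M) - (2 * lam t) * (lam t * G) + (lam t)\<^sup>2 * G"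
    using int by (simp add: lam G_def)
  finally have eq: "(\<integral>x. g (u t x) * (p (u t x) - lam t)\<^sup>2 \<partial>M) =
      (\<integral>x. g (u t x) * (p (u t x))\<^sup>2 \<partial>M) - (lam t)\<^sup>2 * G"
    by (simp add: power2_eq_square)
  show ?th1
    unfolding dissipation_def eq lam G_def[symmetric] using \<open>G \<noteq> 0\<close> by (simp add: power2_eq_square)
  have "(\<integral>x. p (u t x) * u' t x \<partial>M) =
      (\<integral>x. g (u t x) * (p (u t x))\<^sup>2 - lam t * (g (u t x) * p (u t x)) \<partial>M)"
  proof (rule integral_cong_AE)
    show "AE x in M. p (u t x) * u' t x = g (u t x) * (p (u t x))\<^sup>2 - lam t * (g (u t x) * p (u t x))"
      using ode_lam[OF assms]
      by eventually_elim (simp only: power2_eq_square right_diff_distrib left_diff_distrib mult_ac)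
    show "(\<lambda>x. p (u t x) * u' t x) \<in> borel_measurable M"
      using integrable_comp[OF p_cont assms] meas'[OF assms] by auto
  qed (use int in auto)
  also have "\<dots> = (\<integral>x. g (u t x) * (p (u t x))\<^sup>2 \<partial>M) - (lam t)\<^sup>2 * G"
    using int by (simp add: lam power2_eq_square)
  finally show ?th2 unfolding dissipation_def eq by simp
qed

definition lyapunov :: "real \<Rightarrow> real" where
  "lyapunov t = - \<sigma> * (\<integral>x. primitive p (u t x) \<partial>M)"

lemmas primitive_cont = C1_continuous_on[OF primitive_C1[OF p_cont]]

text \<open>Differentiation under the integral sign: along each sequence of times the difference
  quotients are bounded by \<open>L * K\<close> and converge almost everywhere.\<close>

lemma lyapunov_deriv:
  assumes "t > 0"
  shows "(lyapunov has_real_derivative - dissipation t) (at t)"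
proof -
  define En where "En t = (\<integral>x. primitive p (u t x) \<partial>M)" for t
  obtain K where K: "K > 0" "\<And>s t. 0 \<le> s \<Longrightarrow> 0 \<le> t \<Longrightarrow> AE x in M. \<bar>u t x - u s x\<bar> \<le> K * \<bar>t - s\<bar>"
    using AE_Lipschitz by blast
  obtain L where L: "L \<ge> 0" "\<And>y z. \<lbrakk>\<bar>y\<bar> \<le> max \<bar>a\<bar> \<bar>b\<bar>; \<bar>z\<bar> \<le> max \<bar>a\<bar> \<bar>b\<bar>\<rbrakk> \<Longrightarrow>
      \<bar>primitive p y - primitive p z\<bar> \<le> L * \<bar>y - z\<bar>"
    using C1_locally_Lipschitz[OF primitive_C1[OF p_cont], of "max \<bar>a\<bar> \<bar>b\<bar>"] by blast
  have int: "integrable M (\<lambda>x. primitive p (u s x))" if "s \<ge> 0" for s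
    by (rule integrable_comp[OF primitive_cont that])
  have "((\<lambda>s. (En s - En t) / (s - t)) \<longlongrightarrow> (\<integral>x. p (u t x) * u' t x \<partial>M)) (at t within {0..})"
    unfolding tendsto_at_iff_sequentially
  proof (intro allI impI, unfold o_def)
    fix s :: "nat \<Rightarrow> real" assume s: "\<forall>i. s i \<in> {0..} - {t}" and lim: "s \<longlonglongrightarrow> t"
    then have s: "s i \<ge> 0" "s i \<noteq> t" for i by auto
    have t: "t \<ge> 0" using assms by simp
    have "(En (s k) - En t) / (s k - t) =
        (\<integral>x. (primitive p (u (s k) x) - primitive p (u t x)) / (s k - t) \<partial>M)" for k
      unfolding En_def by (subst integral_divide_zero, subst Bochner_Integration.integral_diff) (use int s t in auto)
    moreover have "(\<lambda>k. \<integral>x. (primitive p (u (s k) x) - primitive p (u t x)) / (s k - t) \<partial>M)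
        \<longlonglongrightarrow> (\<integral>x. p (u t x) * u' t x \<partial>M)"
    proof (rule integral_dominated_convergence[where w = "\<lambda>_. L * K"])
      show "(\<lambda>x. p (u t x) * u' t x) \<in> borel_measurable M"
        using integrable_comp[OF p_cont t] meas'[OF t] by auto
      show "(\<lambda>x. (primitive p (u (s k) x) - primitive p (u t x)) / (s k - t)) \<in> borel_measurable M" for k
        using int[OF s(1)] int[OF t] by auto
      show "AE x in M. (\<lambda>k. (primitive p (u (s k) x) - primitive p (u t x)) / (s k - t))
          \<longlonglongrightarrow> p (u t x) * u' t x"
        using AE_tendsto[OF s(1) t lim] AE_tendsto_deriv[OF s t lim]
        by eventually_elim
          (rule tendsto_difference_quotient_chain[OF has_real_derivative_primitive[OF p_cont]])
      show "AE x in M. norm ((primitive p (u (s k) x) - primitive p (u t x)) / (s k - t)) \<le> L * K" for k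
        using K(2)[OF t s(1)[of k]] AE_bounded[OF t] AE_bounded[OF s(1)[of k]]
      proof eventually_elim
        case (elim x)
        have "\<bar>primitive p (u (s k) x) - primitive p (u t x)\<bar> \<le> L * \<bar>u (s k) x - u t x\<bar>"
          by (rule L(2)[OF elim(3,2)])
        also have "\<dots> \<le> L * (K * \<bar>s k - t\<bar>)" using elim(1) L(1) by (rule mult_left_mono)
        finally show ?case using s(2)[of k] by (simp add: abs_divide pos_divide_le_eq mult.assoc)
      qed
    qed simp
    ultimately show "(\<lambda>k. (En (s k) - En t) / (s k - t)) \<longlonglongrightarrow> (\<integral>x. p (u t x) * u' t x \<partial>M)"
      by (simp only:)
  qed
  \<comment> \<open>At a positive time the derivative within the half line is the two-sided
    one.\<close>
  moreover have "at t within {0..} = at t"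
    by (rule at_within_interior) (use assms in simp)
  ultimately have "(En has_real_derivative (\<integral>x. p (u t x) * u' t x \<partial>M)) (at t)"
    by (simp add: has_field_derivative_iff)
  from DERIV_cmult[OF this, of "- \<sigma>"] show ?thesis
    using dissipation_eq(2)[of t] assms unfolding lyapunov_def En_def by simp
qed

lemma lyapunov_mvt:
  assumes "0 < s" "s < t"
  shows "\<exists>z. s < z \<and> z < t \<and> lyapunov s - lyapunov t = (t - s) * dissipation z"
proof -
  obtain z where "s < z" "z < t" "lyapunov t - lyapunov s = (t - s) * - dissipation z"
    using MVT2[of s t lyapunov "\<lambda>z. - dissipation z"] lyapunov_deriv assms by force
  then show ?thesis by (intro exI[of _ z]) auto
qed

lemma lyapunov_bounded: "\<exists>C. \<forall>t\<ge>0. \<bar>lyapunov t\<bar> \<le> C"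
proof -
  obtain C where C: "C \<ge> 0" "\<And>s. \<bar>s\<bar> \<le> max \<bar>a\<bar> \<bar>b\<bar> \<Longrightarrow> \<bar>primitive p s\<bar> \<le> C"
    using continuous_bounded_on_interval[OF primitive_cont] by blast
  have "\<bar>lyapunov t\<bar> \<le> \<bar>\<sigma>\<bar> * (C * measure M (space M))" if "t \<ge> 0" for t
  proof -
    have "\<bar>\<integral>x. primitive p (u t x) \<partial>M\<bar> \<le> (\<integral>x. \<bar>primitive p (u t x)\<bar> \<partial>M)"
      by (rule integral_abs_bound)
    also have "\<dots> \<le> (\<integral>x. C \<partial>M)"
    proof (rule integral_mono_AE)
      show "AE x in M. \<bar>primitive p (u t x)\<bar> \<le> C"
        using AE_bounded[OF that] by eventually_elim (rule C(2))
    qed (use integrable_comp[OF primitive_cont that] in auto)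
    finally have "\<bar>\<integral>x. primitive p (u t x) \<partial>M\<bar> \<le> C * measure M (space M)" by (simp add: mult.commute)
    then show ?thesis unfolding lyapunov_def abs_mult by (simp add: mult_left_mono)
  qed
  then show ?thesis by blast
qed

lemma lyapunov_convergent: "\<exists>l. (lyapunov \<longlongrightarrow> l) at_top"
proof -
  have anti: "lyapunov t \<le> lyapunov s" if "0 < s" "s \<le> t" for s t
  proof (cases "s = t")
    case False
    then have "s < t" using that by simp
    from lyapunov_mvt[OF that(1) this] obtain z
      where "s < z" "lyapunov s - lyapunov t = (t - s) * dissipation z" by blast
    moreover have "(t - s) * dissipation z \<ge> 0"
      using dissipation_nonneg[of z] \<open>s < z\<close> that by simp
    ultimately show ?thesis by simp
  qed simp
  obtain C where C: "\<And>t. t \<ge> 0 \<Longrightarrow> \<bar>lyapunov t\<bar> \<le> C" using lyapunov_bounded by blast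
  \<comment> \<open>Monotonicity is known between positive times only, so the infimum is taken from
    time 1 on.\<close>
  define l where "l = (INF t\<in>{1..}. lyapunov t)"
  have bdd: "bdd_below (lyapunov ` {1..})"
  proof (rule bdd_belowI2)
    show "- C \<le> lyapunov t" if "t \<in> {1..}" for t
      using C[of t] that by (simp add: abs_le_iff)
  qed
  have "(lyapunov \<longlongrightarrow> l) at_top"
  proof (rule decreasing_tendsto)
    show "\<forall>\<^sub>F t in at_top. l \<le> lyapunov t"
      using eventually_ge_at_top[of 1] unfolding l_def
      by eventually_elim (auto intro!: cINF_lower bdd)
    fix y assume "l < y"
    then obtain s where "s \<ge> 1" "lyapunov s < y"
      unfolding l_def using cINF_less_iff[OF _ bdd] by auto
    show "\<forall>\<^sub>F t in at_top. lyapunov t < y"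
      using eventually_ge_at_top[of s]
    proof eventually_elim
      case (elim t)
      then show ?case using anti[of s t] \<open>s \<ge> 1\<close> \<open>lyapunov s < y\<close> by linarith
    qed
  qed
  then show ?thesis ..
qed

end

section \<open>Limit points\<close>

context trapped_flow
begin

text \<open>The hypothesis \<open>zero\<close> is the vanishing of the dissipation of
  \<open>\<phi>\<close>, in the first form of \<open>dissipation_eq\<close>. With
  \<open>l = H / G\<close> it becomes a function of constant sign with zero integral, so
  \<open>g (\<phi> x) = 0\<close> or \<open>p (\<phi> x) = l\<close> almost everywhere.\<close>

lemma stationary_of_zero_dissipation:
  assumes [measurable]: "\<phi> \<in> borel_measurable M" and range: "AE x in M. a \<le> \<phi> x \<and> \<phi> x \<le> b"
    and G: "(\<integral>x. g (\<phi> x) \<partial>M) \<noteq> 0"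
    and zero: "(\<integral>x. g (\<phi> x) * (p (\<phi> x))\<^sup>2 \<partial>M) = (\<integral>x. g (\<phi> x) * p (\<phi> x) \<partial>M)\<^sup>2 / (\<integral>x. g (\<phi> x) \<partial>M)"
  shows "AE x in M. g (\<phi> x) * p (\<phi> x) -
      g (\<phi> x) * ((\<integral>y. g (\<phi> y) * p (\<phi> y) \<partial>M) / (\<integral>y. g (\<phi> y) \<partial>M)) = 0"
proof -
  define G H where "G = (\<integral>x. g (\<phi> x) \<partial>M)" and "H = (\<integral>x. g (\<phi> x) * p (\<phi> x) \<partial>M)"
  define l where "l = H / G"
  have "AE x in M. \<bar>\<phi> x\<bar> \<le> max \<bar>a\<bar> \<bar>b\<bar>" using range by eventually_elim auto
  note int_comp = integrable_continuous_comp[OF _ assms(1) this]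
  have "continuous_on UNIV (\<lambda>s. g s * (p s)\<^sup>2)" "continuous_on UNIV (\<lambda>s. g s * (p s - l)\<^sup>2)"
    by (intro continuous_intros p_cont g_cont)+
  note int = this[THEN int_comp] int_comp[OF gp_cont] int_comp[OF g_cont]
  have "(\<integral>x. g (\<phi> x) * (p (\<phi> x) - l)\<^sup>2 \<partial>M) =
      (\<integral>x. g (\<phi> x) * (p (\<phi> x))\<^sup>2 - (2 * l) * (g (\<phi> x) * p (\<phi> x)) + l\<^sup>2 * g (\<phi> x) \<partial>M)"
    by (rule Bochner_Integration.integral_cong) (auto simp: power2_eq_square algebra_simps)
  also have "\<dots> = H\<^sup>2 / G - (2 * l) * H + l\<^sup>2 * G"
    using int zero by (simp add: G_def H_def)
  also have "\<dots> = 0" using G by (simp add: l_def G_def[symmetric] power2_eq_square field_simps)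
  finally have "(\<integral>x. \<sigma> * (g (\<phi> x) * (p (\<phi> x) - l)\<^sup>2) \<partial>M) = 0" by simp
  moreover have "AE x in M. 0 \<le> \<sigma> * (g (\<phi> x) * (p (\<phi> x) - l)\<^sup>2)"
    using range
  proof eventually_elim
    case (elim x)
    then have "0 \<le> (\<sigma> * g (\<phi> x)) * (p (\<phi> x) - l)\<^sup>2"
      using sign by (intro mult_nonneg_nonneg[OF _ zero_le_power2]) blast
    then show ?case by (simp only: mult.assoc)
  qed
  ultimately have "AE x in M. \<sigma> * (g (\<phi> x) * (p (\<phi> x) - l)\<^sup>2) = 0"
    using int by (subst (asm) integral_nonneg_eq_0_iff_AE) auto
  then show ?thesis
    unfolding G_def[symmetric] H_def[symmetric] l_def[symmetric]
  proof eventually_elim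
    case (elim x)
    have "\<sigma> \<noteq> 0" using sigma by auto
    then have "g (\<phi> x) = 0 \<or> p (\<phi> x) = l" using elim by simp
    then show ?case by auto
  qed
qed

lemma L1_convergent_AE_subseq:
  assumes \<phi>: "integrable M \<phi>" and t: "\<And>n. t n \<ge> 0"
    and lim: "(\<lambda>n. \<integral>\<^sup>+ x. ennreal \<bar>u (t n) x - \<phi> x\<bar> \<partial>M) \<longlonglongrightarrow> 0"
  shows "\<exists>r :: nat \<Rightarrow> nat. strict_mono r \<and> (AE x in M. (\<lambda>n. u (t (r n)) x) \<longlonglongrightarrow> \<phi> x)"
proof -
  have int: "integrable M (\<lambda>x. u (t n) x - \<phi> x)" for n
    using integrable_comp[OF continuous_on_id t, of n] \<phi> by simp
  have "(\<lambda>n. ennreal (\<integral>x. norm (u (t n) x - \<phi> x) \<partial>M)) \<longlonglongrightarrow> ennreal 0"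
    using lim nn_integral_eq_integral[OF integrable_norm[OF int]] by simp
  then have "(\<lambda>n. \<integral>x. norm (u (t n) x - \<phi> x) \<partial>M) \<longlonglongrightarrow> 0"
    by (subst (asm) tendsto_ennreal_iff) auto
  from tendsto_L1_AE_subseq[OF int this] obtain r :: "nat \<Rightarrow> nat"
    where "strict_mono r" "AE x in M. (\<lambda>n. u (t (r n)) x - \<phi> x) \<longlonglongrightarrow> 0" by blast
  then show ?thesis by (auto simp: LIM_zero_iff)
qed

lemma AE_limit_range:
  assumes "\<And>n. t n \<ge> 0" "AE x in M. (\<lambda>n. u (t n) x) \<longlonglongrightarrow> \<phi> x"
  shows "AE x in M. a \<le> \<phi> x \<and> \<phi> x \<le> b"
proof -
  have "AE x in M. \<forall>n. a \<le> u (t n) x \<and> u (t n) x \<le> b"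
    unfolding AE_all_countable using trapped assms(1) by blast
  with assms(2) show ?thesis
  proof eventually_elim
    case (elim x)
    then show ?case using LIMSEQ_le_const[of _ "\<phi> x" a] LIMSEQ_le_const2[of _ "\<phi> x" b] by blast
  qed
qed

text \<open>The Lyapunov function converges as time tends to infinity, so its limit is the same
  along every sequence of times; dominated convergence identifies it at
  \<open>\<phi>\<close>.\<close>

lemma lyapunov_at_limit:
  assumes [measurable]: "\<phi> \<in> borel_measurable M"
    and t: "\<And>n. t n \<ge> 0" "filterlim t at_top sequentially"
    and lim: "AE x in M. (\<lambda>n. u (t n) x) \<longlonglongrightarrow> \<phi> x"
    and l: "(lyapunov \<longlongrightarrow> l) at_top"
  shows "integrable M (\<lambda>x. primitive p (\<phi> x))" "- \<sigma> * (\<integral>x. primitive p (\<phi> x) \<partial>M) = l"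
proof -
  have "AE x in M. \<bar>\<phi> x\<bar> \<le> max \<bar>a\<bar> \<bar>b\<bar>" using AE_limit_range[OF t(1) lim] by eventually_elim auto
  then show "integrable M (\<lambda>x. primitive p (\<phi> x))"
    by (rule integrable_continuous_comp[OF primitive_cont assms(1)])
  have "(\<lambda>n. \<integral>x. primitive p (u (t n) x) \<partial>M) \<longlonglongrightarrow> (\<integral>x. primitive p (\<phi> x) \<partial>M)"
    by (rule tendsto_integral_continuous_comp[OF primitive_cont _ _ AE_bounded lim]) (use t meas in auto)
  then have "(\<lambda>n. lyapunov (t n)) \<longlonglongrightarrow> - \<sigma> * (\<integral>x. primitive p (\<phi> x) \<partial>M)"
    unfolding lyapunov_def by (intro tendsto_mult tendsto_const)
  moreover have "(\<lambda>n. lyapunov (t n)) \<longlonglongrightarrow> l" by (rule filterlim_compose[OF l t(2)])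
  ultimately show "- \<sigma> * (\<integral>x. primitive p (\<phi> x) \<partial>M) = l" by (rule LIMSEQ_unique)
qed

text \<open>The limit is also reached along nearby times with vanishing dissipation: over a time window of
  length \<open>1/m\<close> far out the Lyapunov function drops by less than \<open>1/m\<^sup>2\<close>, while the solution moves
  by at most \<open>K/m\<close>.\<close>

lemma limit_along_small_dissipation:
  assumes t: "\<And>n. t n \<ge> 0" "filterlim t at_top sequentially"
    and lim: "AE x in M. (\<lambda>n. u (t n) x) \<longlonglongrightarrow> \<phi> x"
  obtains \<xi> where "\<And>m. \<xi> m \<ge> 0" "AE x in M. (\<lambda>m. u (\<xi> m) x) \<longlonglongrightarrow> \<phi> x"
    "(\<lambda>m. dissipation (\<xi> m)) \<longlonglongrightarrow> 0"
proof -
  obtain l where l: "(lyapunov \<longlongrightarrow> l) at_top" using lyapunov_convergent by blast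
  have "\<exists>n z. m \<le> n \<and> t n < z \<and> z < t n + 1 / Suc m \<and> dissipation z < 1 / Suc m" for m
  proof -
    define h where "h = 1 / real (Suc m)"
    have "h > 0" by (simp add: h_def)
    have "filterlim (\<lambda>n. t n + h) at_top sequentially"
      by (rule filterlim_at_top_mono[OF t(2)]) (use \<open>h > 0\<close> in auto)
    then have "(\<lambda>n. lyapunov (t n) - lyapunov (t n + h)) \<longlonglongrightarrow> l - l"
      by (intro tendsto_diff filterlim_compose[OF l] t(2))
    then have "\<forall>\<^sub>F n in sequentially. lyapunov (t n) - lyapunov (t n + h) < h * h"
      using \<open>h > 0\<close> by (intro order_tendstoD(2)[where y = "l - l"]) auto
    moreover have "\<forall>\<^sub>F n in sequentially. t n > 0"
      using t(2) by (simp add: filterlim_at_top_dense)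
    ultimately have "\<forall>\<^sub>F n in sequentially. lyapunov (t n) - lyapunov (t n + h) < h * h \<and> t n > 0 \<and> m \<le> n"
      using eventually_ge_at_top[of m] by eventually_elim simp
    from eventually_happens'[OF sequentially_bot this] obtain n where
      n: "lyapunov (t n) - lyapunov (t n + h) < h * h" "t n > 0" "m \<le> n" by blast
    obtain z where z: "t n < z" "z < t n + h" "lyapunov (t n) - lyapunov (t n + h) = h * dissipation z"
      using lyapunov_mvt[OF n(2), of "t n + h"] \<open>h > 0\<close> by auto
    then have "dissipation z < h" using n(1) \<open>h > 0\<close> by simp
    then show ?thesis using z n(3) unfolding h_def by blast
  qed
  then have "\<forall>m. \<exists>n z. m \<le> n \<and> t n < z \<and> z < t n + 1 / Suc m \<and> dissipation z < 1 / Suc m" by blast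
  from choice[OF this] obtain \<nu> where
    "\<forall>m. \<exists>z. m \<le> \<nu> m \<and> t (\<nu> m) < z \<and> z < t (\<nu> m) + 1 / Suc m \<and> dissipation z < 1 / Suc m" by blast
  from choice[OF this] obtain \<xi> where \<nu>: "\<And>m. m \<le> \<nu> m"
    and \<xi>: "\<And>m. t (\<nu> m) < \<xi> m" "\<And>m. \<xi> m < t (\<nu> m) + 1 / Suc m" "\<And>m. dissipation (\<xi> m) < 1 / Suc m"
    by blast
  have pos: "\<xi> m \<ge> 0" for m using t(1)[of "\<nu> m"] \<xi>(1)[of m] by linarith
  have inv: "(\<lambda>m. c / real (Suc m)) \<longlonglongrightarrow> 0" for c
    using tendsto_mult_right_zero[OF LIMSEQ_Suc[OF lim_1_over_n], of c] by simp
  obtain K where K: "K > 0" "\<And>s t. 0 \<le> s \<Longrightarrow> 0 \<le> t \<Longrightarrow> AE x in M. \<bar>u t x - u s x\<bar> \<le> K * \<bar>t - s\<bar>"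
    using AE_Lipschitz by blast
  have "AE x in M. \<forall>m. \<bar>u (\<xi> m) x - u (t (\<nu> m)) x\<bar> \<le> K * \<bar>\<xi> m - t (\<nu> m)\<bar>"
    unfolding AE_all_countable using K(2) pos t(1) by blast
  with lim have conv: "AE x in M. (\<lambda>m. u (\<xi> m) x) \<longlonglongrightarrow> \<phi> x"
  proof eventually_elim
    case (elim x)
    \<comment> \<open>\<open>\<nu>\<close> may fail to be monotone, but
      \<open>m \<le> \<nu> m\<close> makes it tend to infinity.\<close>
    have "filterlim \<nu> at_top sequentially"
      by (rule filterlim_at_top_mono[OF filterlim_ident]) (use \<nu> in auto)
    from filterlim_compose[OF elim(1) this] have "(\<lambda>m. u (t (\<nu> m)) x) \<longlonglongrightarrow> \<phi> x" .
    moreover have "(\<lambda>m. u (\<xi> m) x - u (t (\<nu> m)) x) \<longlonglongrightarrow> 0"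
    proof (rule Lim_null_comparison[OF _ inv[of K]], intro always_eventually allI)
      fix m
      have "K * \<bar>\<xi> m - t (\<nu> m)\<bar> \<le> K * (1 / Suc m)"
        using \<xi>(1,2)[of m] K(1) by (intro mult_left_mono) auto
      then show "norm (u (\<xi> m) x - u (t (\<nu> m)) x) \<le> K / real (Suc m)"
        using elim(2)[rule_format, of m] by simp
    qed
    ultimately have "(\<lambda>m. u (t (\<nu> m)) x + (u (\<xi> m) x - u (t (\<nu> m)) x)) \<longlonglongrightarrow> \<phi> x + 0"
      by (rule tendsto_add)
    then show ?case by simp
  qed
  have "(\<lambda>m. dissipation (\<xi> m)) \<longlonglongrightarrow> 0"
    by (rule tendsto_sandwich[OF _ _ tendsto_const inv[of 1]])
      (use \<xi>(3) dissipation_nonneg[OF pos] in \<open>auto intro!: always_eventually less_imp_le\<close>)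
  then show thesis by (rule that[OF pos conv])
qed

text \<open>In its first form the dissipation is continuous along bounded, almost everywhere
  convergent sequences as soon as the limit of the denominator, the integral of
  \<open>g (\<phi> x)\<close>, is nonzero. Vanishing dissipation thus passes to
  \<open>\<phi>\<close>.\<close>

lemma limit_stationary:
  assumes [measurable]: "\<phi> \<in> borel_measurable M"
    and t: "\<And>n. t n \<ge> 0" "filterlim t at_top sequentially"
    and lim: "AE x in M. (\<lambda>n. u (t n) x) \<longlonglongrightarrow> \<phi> x"
    and G: "(\<integral>x. g (\<phi> x) \<partial>M) \<noteq> 0"
  shows "AE x in M. g (\<phi> x) * p (\<phi> x) -
      g (\<phi> x) * ((\<integral>y. g (\<phi> y) * p (\<phi> y) \<partial>M) / (\<integral>y. g (\<phi> y) \<partial>M)) = 0"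
proof -
  obtain \<xi> where \<xi>: "\<And>m. \<xi> m \<ge> 0" "AE x in M. (\<lambda>m. u (\<xi> m) x) \<longlonglongrightarrow> \<phi> x"
    "(\<lambda>m. dissipation (\<xi> m)) \<longlonglongrightarrow> 0"
    by (rule limit_along_small_dissipation[OF t lim]) blast
  have conv: "(\<lambda>m. \<integral>x. h (u (\<xi> m) x) \<partial>M) \<longlonglongrightarrow> (\<integral>x. h (\<phi> x) \<partial>M)"
    if "continuous_on UNIV h" for h :: "real \<Rightarrow> real"
    by (rule tendsto_integral_continuous_comp[OF that _ _ AE_bounded \<xi>(2)]) (use \<xi>(1) meas in auto)
  have "continuous_on UNIV (\<lambda>s. g s * (p s)\<^sup>2)" by (intro continuous_intros p_cont g_cont)
  note lims = conv[OF this] conv[OF gp_cont] conv[OF g_cont]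
  define Q where "Q = (\<integral>x. g (\<phi> x) * (p (\<phi> x))\<^sup>2 \<partial>M) -
      (\<integral>x. g (\<phi> x) * p (\<phi> x) \<partial>M)\<^sup>2 / (\<integral>x. g (\<phi> x) \<partial>M)"
  have "(\<lambda>m. dissipation (\<xi> m)) \<longlonglongrightarrow> \<sigma> * Q"
    unfolding dissipation_eq(1)[OF \<xi>(1)] Q_def
    by (intro tendsto_intros lims G)
  then have "\<sigma> * Q = 0" using \<xi>(3) by (rule LIMSEQ_unique)
  then have "Q = 0" using sigma by auto
  then show ?thesis
    by (intro stationary_of_zero_dissipation AE_limit_range[OF \<xi>(1,2)] G) (simp_all add: Q_def)
qed

text \<open>The orbit is sampled at integer times: each \<open>u n\<close> is a nondecreasing
  Lipschitz function of \<open>u 0\<close> off a common null set, with constants \<open>K n\<close>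
  that may grow with \<open>n\<close>.\<close>

lemma exists_L1_limit:
  "\<exists>\<phi> t. integrable M \<phi> \<and> (\<forall>n. 0 \<le> t n) \<and> filterlim t at_top sequentially \<and>
      (\<lambda>n. \<integral>\<^sup>+ x. ennreal \<bar>u (t n) x - \<phi> x\<bar> \<partial>M) \<longlonglongrightarrow> 0"
proof -
  define B where "B = max \<bar>a\<bar> \<bar>b\<bar>"
  have "\<forall>n. \<exists>K\<ge>0. \<exists>Q. (AE x in M. Q x) \<and>
      (\<forall>x y. Q x \<longrightarrow> Q y \<longrightarrow> max 0 (u (real n) x - u (real n) y) \<le> K * max 0 (u 0 x - u 0 y))"
    by (intro allI AE_order_Lipschitz) simp
  from choice[OF this] obtain K where "\<forall>n. K n \<ge> 0 \<and> (\<exists>Q. (AE x in M. Q x) \<and>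
      (\<forall>x y. Q x \<longrightarrow> Q y \<longrightarrow> max 0 (u (real n) x - u (real n) y) \<le> K n * max 0 (u 0 x - u 0 y)))" by blast
  then have K: "\<And>n. K n \<ge> 0" and "\<forall>n. \<exists>Q. (AE x in M. Q x) \<and>
      (\<forall>x y. Q x \<longrightarrow> Q y \<longrightarrow> max 0 (u (real n) x - u (real n) y) \<le> K n * max 0 (u 0 x - u 0 y))"
    by blast+
  from choice[OF this(2)] obtain Q where Q: "\<And>n. AE x in M. Q n x"
    "\<And>n x y. Q n x \<Longrightarrow> Q n y \<Longrightarrow> max 0 (u (real n) x - u (real n) y) \<le> K n * max 0 (u 0 x - u 0 y)"
    by blast
  \<comment> \<open>A countable intersection of good sets, on which ordering and bound hold for all
    \<open>n\<close> simultaneously.\<close>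
  define X where "X = {x. \<forall>n. Q n x \<and> \<bar>u (real n) x\<bar> \<le> B}"
  have X: "AE x in M. x \<in> X"
    unfolding X_def mem_Collect_eq AE_all_countable
    using Q(1) AE_bounded[of "real _", folded B_def] by (intro allI AE_conjI) auto
  have "max 0 (u (real n) x - u (real n) y) \<le> K n * max 0 (u 0 x - u 0 y)"
    if "x \<in> X" "y \<in> X" for n x y
    using that by (intro Q(2)) (simp_all add: X_def)
  moreover have "\<bar>u (real n) x\<bar> \<le> B" if "x \<in> X" for n x
    using that by (simp add: X_def)
  ultimately obtain r :: "nat \<Rightarrow> nat" where r: "strict_mono r"
    and conv: "\<forall>x\<in>X. convergent (\<lambda>k. u (real (r k)) x)"
    using Helly_selection_factored[of X "\<lambda>n. u (real n)" K "u 0", OF _ K] by metis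
  define t where "t k = real (r k)" for k
  \<comment> \<open>Outside \<open>X\<close> the sequence may diverge and \<open>lim\<close> is then
    unspecified, which concerns a null set only.\<close>
  define \<phi> where "\<phi> x = lim (\<lambda>k. u (t k) x)" for x
  have [measurable]: "u (t k) \<in> borel_measurable M" for k by (simp add: t_def)
  have [measurable]: "\<phi> \<in> borel_measurable M"
    unfolding \<phi>_def by (rule borel_measurable_lim_metric) simp
  have lim: "AE x in M. (\<lambda>k. u (t k) x) \<longlonglongrightarrow> \<phi> x"
    using X by eventually_elim (use conv in \<open>simp add: \<phi>_def t_def convergent_LIMSEQ_iff\<close>)
  have \<phi>_B: "AE x in M. \<bar>\<phi> x\<bar> \<le> B"
  proof -
    have "AE x in M. a \<le> \<phi> x \<and> \<phi> x \<le> b"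
      by (rule AE_limit_range[OF _ lim]) (simp add: t_def)
    then show ?thesis by eventually_elim (auto simp: B_def)
  qed
  have "integrable M \<phi>"
    using integrable_continuous_comp[OF continuous_on_id _ \<phi>_B] by simp
  moreover have "filterlim t at_top sequentially"
    unfolding t_def by (intro filterlim_compose[OF filterlim_real_sequentially] filterlim_subseq r)
  moreover have "(\<lambda>n. \<integral>\<^sup>+ x. ennreal \<bar>u (t n) x - \<phi> x\<bar> \<partial>M) \<longlonglongrightarrow> (\<integral>\<^sup>+ x. 0 \<partial>M)"
  proof (rule nn_integral_dominated_convergence[where w = "\<lambda>_. ennreal (2 * B)"])
    show "AE x in M. ennreal \<bar>u (t n) x - \<phi> x\<bar> \<le> ennreal (2 * B)" for n
      using \<phi>_B X
    proof eventually_elim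
      case (elim x)
      then have "\<bar>u (t n) x\<bar> \<le> B" by (simp add: X_def t_def)
      then show ?case using elim(1) by (intro ennreal_leI) linarith
    qed
    show "(\<integral>\<^sup>+ x. ennreal (2 * B) \<partial>M) < \<infinity>"
      by (simp add: ennreal_mult_less_top emeasure_eq_measure)
    show "AE x in M. (\<lambda>n. ennreal \<bar>u (t n) x - \<phi> x\<bar>) \<longlonglongrightarrow> 0"
      using lim
    proof eventually_elim
      case (elim x)
      then have "(\<lambda>n. ennreal \<bar>u (t n) x - \<phi> x\<bar>) \<longlonglongrightarrow> ennreal 0"
        by (intro tendsto_ennrealI tendsto_rabs_zero LIM_zero)
      then show ?case by simp
    qed
  qed simp_all
  moreover have "\<forall>n. 0 \<le> t n" by (simp add: t_def)
  ultimately show ?thesis by auto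
qed

end

section \<open>The sign and the interval in the three cases, and the conclusions for limit
  points\<close>

theorem proposition4p3:
  fixes \<Omega> :: "(real^'n) set"
    and p g :: "real \<Rightarrow> real"
    and u0 :: "real^'n \<Rightarrow> real"
    and u :: "real \<Rightarrow> real^'n \<Rightarrow> real"
    and i :: nat
  assumes "open \<Omega>" and "bounded \<Omega>"
    and "p C1_differentiable_on UNIV" and "strict_mono p"
    and "g C1_differentiable_on UNIV" and "g 0 = 0" and "g 1 = 0"
    and "\<And>s. 0 < s \<Longrightarrow> s < 1 \<Longrightarrow> g s > 0"
    and "\<And>s. s < 0 \<or> 1 < s \<Longrightarrow> g s < 0"
    and "(i = 1 \<and> H1 \<Omega> u0) \<or> (i = 2 \<and> H2 \<Omega> g u0) \<or> (i = 3 \<and> H3 \<Omega> u0)"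
    and "is_solution \<Omega> p g u0 \<infinity> u"
  shows "omega_limit \<Omega> u \<noteq> {} \<and>
         (\<exists>E_inf. ((\<lambda>t. E \<Omega> p i (u t)) \<longlongrightarrow> E_inf) at_top \<and>
           (\<forall>\<phi>\<in>omega_limit \<Omega> u.
              integrable (lebesgue_on \<Omega>) (\<lambda>x. primitive p (\<phi> x)) \<and> E \<Omega> p i \<phi> = E_inf)) \<and>
         (\<forall>\<phi>\<in>omega_limit \<Omega> u.
           has_bochner_integral (lebesgue_on \<Omega>) (\<lambda>x. g (\<phi> x)) 0 \<or> is_stationary \<Omega> p g \<phi>)"
proof -
  let ?M = "lebesgue_on \<Omega>"
  have J: "{t. 0 \<le> t \<and> ereal t < \<infinity>} = {0..}" by auto
  from assms(11) obtain u' where init: "AE x in ?M. u 0 x = u0 x"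
    and mass: "\<And>t. t \<ge> 0 \<Longrightarrow> (LINT x|?M. g (u t x)) \<noteq> 0"
    and C1: "C1_Linf_on ?M {0..} u u'"
    and ode: "\<And>t. t \<ge> 0 \<Longrightarrow> AE x in ?M. u' t x = F \<Omega> p g (u t) x"
    unfolding is_solution_def J Let_def by auto
  have "\<Omega> \<in> lmeasurable" using assms(1,2) by (intro lmeasurable_open)
  then interpret finite_measure ?M by (rule finite_measure_lebesgue_on)
  interpret C1_curve ?M u u' by (rule C1_curve_if_C1_Linf_on[OF C1])
  interpret nonlocal_flow ?M u u' p g
    by unfold_locales (use assms(3-5) mass ode in \<open>auto simp: F_def\<close>)
  \<comment> \<open>The sign of \<open>g\<close> on the relevant interval: 1 for
    \<open>i = 2\<close>, -1 for \<open>i = 1\<close> and \<open>i = 3\<close>. Then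
    \<open>- \<sigma>\<close> is the factor in \<open>E\<close>, so \<open>lyapunov\<close> is the
    energy along the orbit.\<close>
  define \<sigma> :: real where "\<sigma> = (- 1) ^ i"
  have g_neg: "g s \<le> 0" if "s \<le> 0 \<or> 1 \<le> s" for s
    using assms(6,7) assms(9)[of s] that by (cases "s = 0 \<or> s = 1") (auto intro: less_imp_le)
  have g_pos: "g s \<ge> 0" if "0 \<le> s" "s \<le> 1" for s
    using assms(6,7) assms(8)[of s] that by (cases "s = 0 \<or> s = 1") (auto intro: less_imp_le)
  have ge0: "AE x in ?M. 0 \<le> u t x" if "t \<ge> 0" "AE x in ?M. 0 \<le> u 0 x" for t
    using AE_zero_barrier[OF that(1) assms(6)] that(2) by eventually_elim simp
  have le0: "AE x in ?M. u t x \<le> 0" if "t \<ge> 0" "AE x in ?M. u 0 x \<le> 0" for t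
    using AE_zero_barrier[OF that(1) assms(6)] that(2) by eventually_elim simp
  have ge1: "AE x in ?M. 1 \<le> u t x" if "t \<ge> 0" "AE x in ?M. 1 \<le> u 0 x" for t
    using AE_zero_barrier[OF that(1) assms(7)] that(2) by eventually_elim simp
  have le1: "AE x in ?M. u t x \<le> 1" if "t \<ge> 0" "AE x in ?M. u 0 x \<le> 1" for t
    using AE_zero_barrier[OF that(1) assms(7)] that(2) by eventually_elim simp
  \<comment> \<open>The intervals are \<open>[1, B]\<close>, \<open>[0, 1]\<close> and
    \<open>[- c, 0]\<close>. End points at zeros of \<open>g\<close> are barriers; \<open>B\<close>
    and \<open>- c\<close> come from the essential bound of \<open>u0\<close> through
    \<open>AE_le_of_ge_1\<close> and \<open>AE_ge_of_le_0\<close>.\<close>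
  have "\<exists>a b. (\<forall>t\<ge>0. AE x in ?M. a \<le> u t x \<and> u t x \<le> b) \<and> (\<forall>s. a \<le> s \<longrightarrow> s \<le> b \<longrightarrow> \<sigma> * g s \<ge> 0)"
    using assms(10)
  proof (elim disjE conjE)
    assume "i = 1" "H1 \<Omega> u0"
    then have "u0 \<in> Linf ?M" "AE x in ?M. 1 \<le> u0 x" by (auto simp: H1_def)
    obtain c where "c \<ge> 0" "AE x in ?M. \<bar>u0 x\<bar> \<le> c" using Linf_AE_bounded[OF \<open>u0 \<in> _\<close>] .
    \<comment> \<open>The maximum secures \<open>1 \<le> B\<close>, as \<open>AE_le_of_ge_1\<close>
      requires.\<close>
    define B where "B = max 1 c"
    have B: "AE x in ?M. 1 \<le> u 0 x \<and> u 0 x \<le> B"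
      using init \<open>AE x in ?M. 1 \<le> u0 x\<close> \<open>AE x in ?M. \<bar>u0 x\<bar> \<le> c\<close>
      by eventually_elim (auto simp: B_def)
    have "AE x in ?M. u t x \<le> B" if "t \<ge> 0" for t
      by (rule AE_le_of_ge_1[OF assms(7) _ B _ that]) (auto simp: B_def g_neg)
    moreover have "AE x in ?M. 1 \<le> u 0 x" using B by eventually_elim simp
    ultimately show ?thesis
      using ge1 g_neg \<open>i = 1\<close> by (intro exI[of _ 1] exI[of _ B]) (auto simp: \<sigma>_def AE_conj_iff)
  next
    assume "i = 2" "H2 \<Omega> g u0"
    then have "AE x in ?M. 0 \<le> u0 x \<and> u0 x \<le> 1" by (auto simp: H2_def)
    with init have "AE x in ?M. 0 \<le> u 0 x" "AE x in ?M. u 0 x \<le> 1" by (eventually_elim, simp)+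
    then show ?thesis
      using ge0 le1 g_pos \<open>i = 2\<close> by (intro exI[of _ 0] exI[of _ 1]) (auto simp: \<sigma>_def AE_conj_iff)
  next
    assume "i = 3" "H3 \<Omega> u0"
    then have "u0 \<in> Linf ?M" "AE x in ?M. u0 x \<le> 0" by (auto simp: H3_def)
    obtain c where "c \<ge> 0" "AE x in ?M. \<bar>u0 x\<bar> \<le> c" using Linf_AE_bounded[OF \<open>u0 \<in> _\<close>] .
    have B: "AE x in ?M. - c \<le> u 0 x \<and> u 0 x \<le> 0"
      using init \<open>AE x in ?M. u0 x \<le> 0\<close> \<open>AE x in ?M. \<bar>u0 x\<bar> \<le> c\<close>
      by eventually_elim auto
    have "AE x in ?M. - c \<le> u t x" if "t \<ge> 0" for t
      by (rule AE_ge_of_le_0[OF assms(6) _ B \<open>c \<ge> 0\<close> that]) (auto simp: g_neg)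
    moreover have "AE x in ?M. u 0 x \<le> 0" using B by eventually_elim simp
    ultimately show ?thesis
      using le0 g_neg \<open>i = 3\<close> by (intro exI[of _ "- c"] exI[of _ 0]) (auto simp: \<sigma>_def AE_conj_iff)
  qed
  then obtain a b where "\<And>t. t \<ge> 0 \<Longrightarrow> AE x in ?M. a \<le> u t x \<and> u t x \<le> b"
    "\<And>s. a \<le> s \<Longrightarrow> s \<le> b \<Longrightarrow> \<sigma> * g s \<ge> 0" by blast
  moreover have "\<sigma> * \<sigma> = 1" by (simp add: \<sigma>_def power_mult_distrib[symmetric])
  ultimately interpret trapped_flow ?M u u' p g a b \<sigma>
    by unfold_locales
  have E_eq: "E \<Omega> p i v = - \<sigma> * (LINT x|?M. primitive p (v x))" for v
    by (simp add: E_def \<sigma>_def)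
  obtain l where l: "(lyapunov \<longlongrightarrow> l) at_top" using lyapunov_convergent by blast
  have lim_l: "((\<lambda>t. E \<Omega> p i (u t)) \<longlongrightarrow> l) at_top" using l unfolding E_eq lyapunov_def .
  have "omega_limit \<Omega> u \<noteq> {}"
    using exists_L1_limit unfolding omega_limit_def by blast
  moreover have "integrable ?M (\<lambda>x. primitive p (\<phi> x)) \<and> E \<Omega> p i \<phi> = l \<and>
      (has_bochner_integral ?M (\<lambda>x. g (\<phi> x)) 0 \<or> is_stationary \<Omega> p g \<phi>)"
    if "\<phi> \<in> omega_limit \<Omega> u" for \<phi>
  proof -
    from that obtain t where \<phi>: "integrable ?M \<phi>" and t: "\<And>n. 0 \<le> t n" "filterlim t at_top sequentially"
      "(\<lambda>n. \<integral>\<^sup>+ x. ennreal \<bar>u (t n) x - \<phi> x\<bar> \<partial>?M) \<longlonglongrightarrow> 0"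
      unfolding omega_limit_def by blast
    \<comment> \<open>Convergence in \<open>L\<^sup>1\<close> gives almost everywhere convergence
      after passing to a subsequence, whose times still tend to infinity.\<close>
    from L1_convergent_AE_subseq[OF \<phi> t(1,3)] obtain r :: "nat \<Rightarrow> nat"
      where r: "strict_mono r" and lim: "AE x in ?M. (\<lambda>n. u (t (r n)) x) \<longlonglongrightarrow> \<phi> x" by blast
    have tr: "filterlim (\<lambda>n. t (r n)) at_top sequentially"
      by (rule filterlim_compose[OF t(2) filterlim_subseq[OF r]])
    have meas_\<phi>: "\<phi> \<in> borel_measurable ?M" using \<phi> by auto
    have bound: "AE x in ?M. \<bar>\<phi> x\<bar> \<le> max \<bar>a\<bar> \<bar>b\<bar>"
      using AE_limit_range[OF t(1) lim] by eventually_elim auto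
    have "has_bochner_integral ?M (\<lambda>x. g (\<phi> x)) 0 \<or> is_stationary \<Omega> p g \<phi>"
    proof (cases "(LINT x|?M. g (\<phi> x)) = 0")
      case True
      \<comment> \<open>Integrability shows that 0 is the true value of the integral and not the
        default for nonintegrable functions.\<close>
      then show ?thesis
        using has_bochner_integral_integrable[OF integrable_continuous_comp[OF g_cont meas_\<phi> bound]]
        by simp
    next
      case False
      then show ?thesis
        unfolding is_stationary_def F_def
        using Linf_of_AE_bounded[OF meas_\<phi> bound] limit_stationary[OF meas_\<phi> t(1) tr lim False]
        by blast
    qed
    then show ?thesis
      using lyapunov_at_limit[OF meas_\<phi> t(1) tr lim l] by (simp add: E_eq)
  qed
  ultimately show ?thesis using lim_l by blast
qed

end
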